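(* Let $\alpha>0$, let $N>1$, and let $\Theta$ be any instance of the $N$-armed bandit problem, with optimal arm $i^*$. Suppose the actions $a(1),a(2),\dots$ are generated by the QCARE policy with parameter $\alpha$. Then: (1) $\Pr(a(t)=i^* )\to 1$ as $t\to\infty$; (2) the regret satisfies $\mathcal R^\Theta(T)=o(T)$ as $T\to\infty$. As a result, QCARE with parameter $\alpha$ is long-run-average optimal, i.e. it maximizes $\limsup_{T\to\infty}\frac1T\,\mathbb E\big[\sum_{t=1}^T r_{a(t)}(t)\big]$ over all admissible policies.
   Context: Bandit problem. There are $N$ arms, $[N]=\{1,\dots,N\}$. Each arm $i$ has an i.i.d. reward sequence $\{r_i(t)\}_{t\ge1}$ drawn from a fixed distribution supported on $[0,1]$ with mean $\mu_i$; the collection of reward distributions is the instance $\Theta$. The optimal arm $i^*=\arg\max_i\mu_i$ is assumed unique, and $\mu^*=\max_i\mu_i$. At each time $t=1,2,\dots$ an action $a(t)\in[N]$ is chosen and the reward $r_{a(t)}(t)$ is observed; conditionally on the past and on $a(t)=i$, this reward has arm $i$'s distribution. An admissible policy maps each history $(a(1),r_{a(1)}(1),\dots,a(t-1),r_{a(t-1)}(t-1))$ to a (possibly randomized) action $a(t)$. The regret on instance $\Theta$ is $\mathcal R^\Theta(T)=\mu^*T-\mathbb E\big[\sum_{t=1}^T r_{a(t)}(t)\big]$. QCARE. Let $k_i(t)=\sum_{\ell=1}^{t-1}\mathbb I\{a(\ell)=i\}$ and $\hat\mu_i(t)=\frac{1}{k_i(t)+1}\sum_{\ell\le t-1:\,a(\ell)=i}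 r_i(\ell)$. The QCARE policy with parameter $\alpha$ plays at each time $t$ the arm $a(t)=\arg\max_i\theta_i(t)$, where $\theta_i(t)=\hat\mu_i(t)+\frac{\epsilon_{it}}{(k_i(t)+1)^\alpha}$ and the $\epsilon_{it}$ are independent standard normal random variables (independent of the rewards). Notation: $f(T)=o(g(T))$ means $\limsup_{T\to\infty}f(T)/g(T)=0$. *)

theory Defs
  imports "HOL-Probability.Probability"
begin

section \<open>Bandit instances\<close>

text \<open>Arms are the elements of \<open>{1..N}\<close> and time steps start at \<open>1\<close>; values of sequences at time
  \<open>0\<close> are irrelevant. An instance assigns to each arm \<open>i\<close> its reward distribution \<open>D i\<close>.\<close>

definition arm_mean :: "(nat \<Rightarrow> real measure) \<Rightarrow> nat \<Rightarrow> real" where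
  "arm_mean D i = (\<integral>x. x \<partial>D i)"

definition bandit_instance :: "nat \<Rightarrow> (nat \<Rightarrow> real measure) \<Rightarrow> bool" where
  "bandit_instance N D \<longleftrightarrow>
     (\<forall>i\<in>{1..N}. prob_space (D i) \<and> sets (D i) = sets borel \<and> (AE x in D i. x \<in> {0..1}))"

definition unique_optimal_arm :: "nat \<Rightarrow> (nat \<Rightarrow> real measure) \<Rightarrow> nat \<Rightarrow> bool" where
  "unique_optimal_arm N D i \<longleftrightarrow>
     is_arg_max (arm_mean D) (\<lambda>j. j \<in> {1..N}) i \<and>
     (\<forall>j. is_arg_max (arm_mean D) (\<lambda>j. j \<in> {1..N}) j \<longrightarrow> j = i)"

definition optimal_mean :: "nat \<Rightarrow> (nat \<Rightarrow> real measure) \<Rightarrow> real" where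
  "optimal_mean N D = Max (arm_mean D ` {1..N})"

definition expected_total_reward :: "'w measure \<Rightarrow> (nat \<Rightarrow> 'w \<Rightarrow> real) \<Rightarrow> nat \<Rightarrow> real" where
  "expected_total_reward M X T = (\<integral>\<omega>. (\<Sum>t\<in>{1..T}. X t \<omega>) \<partial>M)"

definition regret ::
  "nat \<Rightarrow> (nat \<Rightarrow> real measure) \<Rightarrow> 'w measure \<Rightarrow> (nat \<Rightarrow> 'w \<Rightarrow> real) \<Rightarrow> nat \<Rightarrow> real" where
  "regret N D M X T = optimal_mean N D * real T - expected_total_reward M X T"

definition long_run_average_reward :: "'w measure \<Rightarrow> (nat \<Rightarrow> 'w \<Rightarrow> real) \<Rightarrow> ereal" where
  "long_run_average_reward M X = limsup (\<lambda>T. ereal (1 / real T * expected_total_reward M X T))"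


section \<open>Admissible policies\<close>

text \<open>The history before time \<open>t\<close> consists of the pairs (action, observed reward) at times
  \<open>1, ..., t - 1\<close>.\<close>

definition history_space :: "nat \<Rightarrow> nat \<Rightarrow> (nat \<Rightarrow> nat \<times> real) measure" where
  "history_space N t = (\<Pi>\<^sub>M l\<in>{1..<t}. count_space {1..N} \<Otimes>\<^sub>M borel)"

definition history ::
  "(nat \<Rightarrow> 'w \<Rightarrow> nat) \<Rightarrow> (nat \<Rightarrow> 'w \<Rightarrow> real) \<Rightarrow> nat \<Rightarrow> 'w \<Rightarrow> nat \<Rightarrow> nat \<times> real" where
  "history a X t \<omega> = (\<lambda>l\<in>{1..<t}. (a l \<omega>, X l \<omega>))"

text \<open>A possibly randomized action is a probability measure on the arms, so a policy is a
  sequence of probability kernels from histories to arms.\<close>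

definition admissible_policy ::
  "nat \<Rightarrow> (nat \<Rightarrow> (nat \<Rightarrow> nat \<times> real) \<Rightarrow> nat measure) \<Rightarrow> bool" where
  "admissible_policy N \<pi> \<longleftrightarrow>
     (\<forall>t\<ge>1. \<pi> t \<in> history_space N t \<rightarrow>\<^sub>M prob_algebra (count_space {1..N}))"

text \<open>\<open>policy_run N D \<pi> M a X\<close>: on the probability space \<open>M\<close>, the actions \<open>a\<close> and the observed
  rewards \<open>X\<close> arise from policy \<open>\<pi>\<close> on the instance \<open>D\<close>. The assumption \<open>action_law\<close> says that
  the conditional law of the action given the history \<open>H\<close> is \<open>\<pi> t H\<close>, and \<open>reward_law\<close> says
  that given the history and the action \<open>i\<close> the observed reward has law \<open>D i\<close>.\<close>

locale policy_run = prob_space M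
  for N :: nat and D :: "nat \<Rightarrow> real measure"
    and \<pi> :: "nat \<Rightarrow> (nat \<Rightarrow> nat \<times> real) \<Rightarrow> nat measure"
    and M :: "'w measure" and a :: "nat \<Rightarrow> 'w \<Rightarrow> nat" and X :: "nat \<Rightarrow> 'w \<Rightarrow> real" +
  assumes action_measurable: "\<And>t. t \<ge> 1 \<Longrightarrow> a t \<in> M \<rightarrow>\<^sub>M count_space {1..N}"
    and reward_measurable: "\<And>t. t \<ge> 1 \<Longrightarrow> X t \<in> borel_measurable M"
    and action_law: "\<And>t i A. t \<ge> 1 \<Longrightarrow> i \<in> {1..N} \<Longrightarrow> A \<in> sets (history_space N t) \<Longrightarrow>
      prob {\<omega>\<in>space M. history a X t \<omega> \<in> A \<and> a t \<omega> = i} =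
      (\<integral>\<omega>. indicator A (history a X t \<omega>) * measure (\<pi> t (history a X t \<omega>)) {i} \<partial>M)"
    and reward_law: "\<And>t i A B. t \<ge> 1 \<Longrightarrow> i \<in> {1..N} \<Longrightarrow> A \<in> sets (history_space N t) \<Longrightarrow>
      B \<in> sets borel \<Longrightarrow>
      prob {\<omega>\<in>space M. history a X t \<omega> \<in> A \<and> a t \<omega> = i \<and> X t \<omega> \<in> B} =
      prob {\<omega>\<in>space M. history a X t \<omega> \<in> A \<and> a t \<omega> = i} * measure (D i) B"


section \<open>The QCARE policy\<close>

definition num_plays :: "(nat \<Rightarrow> 'w \<Rightarrow> nat) \<Rightarrow> nat \<Rightarrow> nat \<Rightarrow> 'w \<Rightarrow> nat" where
  "num_plays a i t \<omega> = card {l\<in>{1..<t}. a l \<omega> = i}"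

definition emp_mean ::
  "(nat \<Rightarrow> nat \<Rightarrow> 'w \<Rightarrow> real) \<Rightarrow> (nat \<Rightarrow> 'w \<Rightarrow> nat) \<Rightarrow> nat \<Rightarrow> nat \<Rightarrow> 'w \<Rightarrow> real" where
  "emp_mean r a i t \<omega> =
     1 / (real (num_plays a i t \<omega>) + 1) * (\<Sum>l\<in>{l\<in>{1..<t}. a l \<omega> = i}. r i l \<omega>)"

definition qcare_index ::
  "real \<Rightarrow> (nat \<Rightarrow> nat \<Rightarrow> 'w \<Rightarrow> real) \<Rightarrow> (nat \<Rightarrow> nat \<Rightarrow> 'w \<Rightarrow> real) \<Rightarrow> (nat \<Rightarrow> 'w \<Rightarrow> nat)
    \<Rightarrow> nat \<Rightarrow> nat \<Rightarrow> 'w \<Rightarrow> real" where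
  "qcare_index \<alpha> r \<epsilon> a i t \<omega> =
     emp_mean r a i t \<omega> + \<epsilon> i t \<omega> / (real (num_plays a i t \<omega>) + 1) powr \<alpha>"

text \<open>Here \<open>r i t\<close> is the reward of arm \<open>i\<close> at time \<open>t\<close> and \<open>\<epsilon> i t\<close> the Gaussian noise. The reward
  vectors of different times are independent, but rewards of different arms at the same time may be
  dependent. Ties in the maximization have probability \<open>0\<close> and may be broken in any measurable
  way.\<close>

locale qcare_run = prob_space M
  for N :: nat and D :: "nat \<Rightarrow> real measure" and \<alpha> :: real
    and M :: "'w measure" and r :: "nat \<Rightarrow> nat \<Rightarrow> 'w \<Rightarrow> real" and \<epsilon> :: "nat \<Rightarrow> nat \<Rightarrow> 'w \<Rightarrow> real"
    and a :: "nat \<Rightarrow> 'w \<Rightarrow> nat" +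
  assumes reward_distr: "\<And>i t. i \<in> {1..N} \<Longrightarrow> t \<ge> 1 \<Longrightarrow> distr M borel (r i t) = D i"
    and reward_indep: "indep_vars (\<lambda>_. \<Pi>\<^sub>M i\<in>{1..N}. borel) (\<lambda>t \<omega>. \<lambda>i\<in>{1..N}. r i t \<omega>) {1..}"
    and noise_distr: "\<And>i t. i \<in> {1..N} \<Longrightarrow> t \<ge> 1 \<Longrightarrow>
      distributed M lborel (\<epsilon> i t) std_normal_density"
    and noise_indep: "indep_vars (\<lambda>_. borel) (\<lambda>(i, t). \<epsilon> i t) ({1..N} \<times> {1..})"
    and reward_noise_indep: "indep_var
      (\<Pi>\<^sub>M it\<in>{1..N} \<times> {1..}. borel) (\<lambda>\<omega>. \<lambda>(i, t)\<in>{1..N} \<times> {1..}. r i t \<omega>)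
      (\<Pi>\<^sub>M it\<in>{1..N} \<times> {1..}. borel) (\<lambda>\<omega>. \<lambda>(i, t)\<in>{1..N} \<times> {1..}. \<epsilon> i t \<omega>)"
    and action_measurable: "\<And>t. t \<ge> 1 \<Longrightarrow> a t \<in> M \<rightarrow>\<^sub>M count_space {1..N}"
    and action_arg_max: "\<And>t \<omega>. t \<ge> 1 \<Longrightarrow> \<omega> \<in> space M \<Longrightarrow>
      is_arg_max (\<lambda>i. qcare_index \<alpha> r \<epsilon> a i t \<omega>) (\<lambda>i. i \<in> {1..N}) (a t \<omega>)"

definition observed_reward ::
  "(nat \<Rightarrow> nat \<Rightarrow> 'w \<Rightarrow> real) \<Rightarrow> (nat \<Rightarrow> 'w \<Rightarrow> nat) \<Rightarrow> nat \<Rightarrow> 'w \<Rightarrow> real" where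
  "observed_reward r a t \<omega> = r (a t \<omega>) t \<omega>"

end

theory Submission
  imports Defs "HOL-Real_Asymp.Real_Asymp"
begin

text \<open>
  While arm \<open>i\<close> has fewer than \<open>K\<close> plays, its noise is divided by at most \<open>K powr \<alpha>\<close>, so whenever
  \<open>\<epsilon> i t > K powr \<alpha>\<close> and the noise of all other arms is nonpositive, arm \<open>i\<close> is played. These events
  are independent with a constant positive probability, hence for fixed \<open>K\<close> the probability that some
  arm has fewer than \<open>K\<close> plays tends to \<open>0\<close>. An exponential supermartingale bounds the probability
  that an arm has at least \<open>K\<close> plays and an empirical mean off by more than \<open>\<delta>\<close> by an exponentially
  small quantity in \<open>K\<close>, uniformly in time, and the same holds for the scaled noise by Chebyshev's
  inequality. Outside these events the indices are ordered like the means. The regret bound is then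
  Cesaro summation, and no policy collects more than the optimal mean per step.

  The supermartingale only uses that a reward is independent of the history given the action. It is
  therefore set up for runs of arbitrary policies, and a QCARE run is shown to be a run of an
  admissible policy, since ties have probability \<open>0\<close>.
\<close>

section \<open>Runs of a policy\<close>

text \<open>Two dependencies shape the proof. The number of plays of an arm depends on the rewards
  it has produced, so Hoeffding's inequality for a fixed sample size does not apply to its empirical
  mean. The play count is therefore kept inside the exponential, and the event of at least
  \<open>K\<close> plays is inserted only afterwards; no union over possible counts is taken, hence
  no factor grows with time. For the noise, the random count is replaced by its lower bound
  \<open>K\<close>, so that the tail of a single Gaussian suffices. No rates enter: time tends to
  infinity for fixed \<open>K\<close>, and only then \<open>K\<close> grows, which is why every
  positive \<alpha> is covered. The other dependency is hidden in the actions, which are only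
  assumed to maximize the index and may break ties with knowledge of the future. Independence of the
  history from the current noise and rewards has to be recovered almost surely: as long as no tie
  has occurred, the history is a function of past noise and rewards, so the current noise is
  independent of it, and this excludes a tie in the current round.\<close>

lemma real_num_plays: "real (num_plays a i t \<omega>) = (\<Sum>l\<in>{1..<t}. of_bool (a l \<omega> = i))"
proof -
  have "{l\<in>{1..<t}. a l \<omega> = i} = {1..<t} \<inter> {l. a l \<omega> = i}"
    by auto
  then show ?thesis
    by (simp add: num_plays_def)
qed

lemma num_plays_Suc:
  "t \<ge> 1 \<Longrightarrow> num_plays a i (Suc t) \<omega> = num_plays a i t \<omega> + of_bool (a t \<omega> = i)"
proof -
  assume "t \<ge> 1"
  then have "real (num_plays a i (Suc t) \<omega>) = real (num_plays a i t \<omega> + of_bool (a t \<omega> = i))"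
    unfolding real_num_plays of_nat_add by (simp add: of_bool_def)
  then show ?thesis
    by (simp only: of_nat_eq_iff)
qed

text \<open>The martingale part of the rewards collected from arm \<open>i\<close> when \<mu> is its
  mean. It reads only actions and observed rewards, so it makes sense for a run of any
  policy.\<close>

definition reward_deviation ::
  "(nat \<Rightarrow> 'w \<Rightarrow> nat) \<Rightarrow> (nat \<Rightarrow> 'w \<Rightarrow> real) \<Rightarrow> nat \<Rightarrow> real \<Rightarrow> nat \<Rightarrow> 'w \<Rightarrow> real" where
  "reward_deviation a X i \<mu> t \<omega> = (\<Sum>l\<in>{1..<t}. of_bool (a l \<omega> = i) * (X l \<omega> - \<mu>))"

lemma reward_deviation_Suc:
  "t \<ge> 1 \<Longrightarrow>
    reward_deviation a X i \<mu> (Suc t) \<omega> = reward_deviation a X i \<mu> t \<omega> + of_bool (a t \<omega> = i) * (X t \<omega> - \<mu>)"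
  by (simp add: reward_deviation_def)

text \<open>The denominator is the number of plays plus one, as if a reward 0 had been seen at the
  start. This fictitious observation is the extra \<open>- \<mu>\<close> in the numerator.\<close>

lemma emp_mean_deviation:
  "emp_mean r a i t \<omega> - \<mu> =
    (reward_deviation a (observed_reward r a) i \<mu> t \<omega> - \<mu>) / (real (num_plays a i t \<omega>) + 1)"
proof -
  let ?A = "{l\<in>{1..<t}. a l \<omega> = i}"
  have "reward_deviation a (observed_reward r a) i \<mu> t \<omega> = (\<Sum>l\<in>?A. r i l \<omega> - \<mu>)"
    unfolding reward_deviation_def
    by (rule sum.mono_neutral_cong_right) (auto simp: observed_reward_def)
  also have "\<dots> = (\<Sum>l\<in>?A. r i l \<omega>) - real (num_plays a i t \<omega>) * \<mu>"
    by (simp add: sum_subtractf num_plays_def)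
  finally show ?thesis
    by (simp add: emp_mean_def field_simps)
qed

section \<open>Integration over a single step of a run\<close>

locale bandit_run = policy_run +
  assumes bandit: "bandit_instance N D"
begin

lemma reward_space:
  assumes "i \<in> {1..N}"
  shows "prob_space (D i)" and sets_reward: "sets (D i) = sets borel"
    and reward_bounded: "AE x in D i. x \<in> {0..1}"
  using bandit assms by (auto simp: bandit_instance_def)

lemma history_measurable:
  assumes "t \<ge> 1"
  shows "history a X t \<in> M \<rightarrow>\<^sub>M history_space N t"
  unfolding history_def history_space_def
  by (rule measurable_restrict)
    (use action_measurable reward_measurable in \<open>auto intro!: measurable_Pair\<close>)

lemma measurable_indicator_action:
  assumes "t \<ge> 1" "i \<in> {1..N}"
  shows "(\<lambda>\<omega>. indicator {i} (a t \<omega>) :: ennreal) \<in> borel_measurable M"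
  by (rule measurable_compose[OF action_measurable borel_measurable_indicator]) (use assms in auto)

text \<open>\<open>reward_law\<close> gives independence on rectangles only; uniqueness of product
  measures extends it to functions. Nonnegative integrals spare any integrability condition on the
  exponentials to which this is applied.\<close>

lemma nn_integral_reward_step:
  assumes t: "t \<ge> 1" and i: "i \<in> {1..N}"
    and f: "f \<in> borel_measurable (history_space N t)" and g: "g \<in> borel_measurable borel"
  shows "(\<integral>\<^sup>+\<omega>. f (history a X t \<omega>) * indicator {i} (a t \<omega>) * g (X t \<omega>) \<partial>M) =
    (\<integral>\<^sup>+\<omega>. f (history a X t \<omega>) * indicator {i} (a t \<omega>) \<partial>M) * (\<integral>\<^sup>+x. g x \<partial>D i)"
proof -
  define H where "H = history a X t"
  have H[measurable]: "H \<in> M \<rightarrow>\<^sub>M history_space N t"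
    using history_measurable[OF t] by (simp add: H_def)
  note [measurable] = action_measurable[OF t] reward_measurable[OF t] f g
  have i_sets[measurable]: "{i} \<in> sets (count_space {1..N})"
    using i by simp
  note [measurable] = measurable_indicator_action[OF t i]
  \<comment> \<open>\<open>M\<close> restricted to the event that arm \<open>i\<close> is played. It
    is finite but in general not a probability measure; under it the pair of history and reward has
    a product law.\<close>
  define M1 where "M1 = density M (\<lambda>\<omega>. indicator {i} (a t \<omega>))"
  have M1_sets[measurable_cong, simp]: "sets M1 = sets M" and M1_space[simp]: "space M1 = space M"
    by (simp_all add: M1_def)
  have event: "emeasure M1 E = emeasure M {\<omega>\<in>space M. \<omega> \<in> E \<and> a t \<omega> = i}" if "E \<in> sets M" for E
  proof -
    have "emeasure M1 E = (\<integral>\<^sup>+\<omega>. indicator {\<omega>\<in>space M. \<omega> \<in> E \<and> a t \<omega> = i} \<omega> \<partial>M)"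
      unfolding M1_def using that
      by (subst emeasure_density, measurable, intro nn_integral_cong) (auto split: split_indicator)
    also have "\<dots> = emeasure M {\<omega>\<in>space M. \<omega> \<in> E \<and> a t \<omega> = i}"
    proof (rule nn_integral_indicator)
      have "{\<omega>\<in>space M. \<omega> \<in> E \<and> a t \<omega> = i} = E \<inter> (a t -` {i} \<inter> space M)"
        using sets.sets_into_space[OF that] by auto
      then show "{\<omega>\<in>space M. \<omega> \<in> E \<and> a t \<omega> = i} \<in> sets M"
        using that by simp
    qed
    finally show ?thesis .
  qed
  interpret M1: finite_measure M1
    by (rule finite_measureI) (simp add: event)
  interpret D: prob_space "D i"
    by (rule reward_space[OF i])
  have D_sets[measurable_cong, simp]: "sets (D i) = sets borel"
    by (rule sets_reward[OF i])
  have "distr M1 (history_space N t) H \<Otimes>\<^sub>M D i =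
    distr M1 (history_space N t \<Otimes>\<^sub>M borel) (\<lambda>\<omega>. (H \<omega>, X t \<omega>))"
  proof (rule pair_measure_eqI)
    have "finite_measure (distr M1 (history_space N t) H)"
      by (rule M1.finite_measure_distr) simp
    then show "sigma_finite_measure (distr M1 (history_space N t) H)"
      by (rule finite_measure.axioms)
    show "sigma_finite_measure (D i)"
      by unfold_locales
    show "sets (distr M1 (history_space N t) H \<Otimes>\<^sub>M D i) =
        sets (distr M1 (history_space N t \<Otimes>\<^sub>M borel) (\<lambda>\<omega>. (H \<omega>, X t \<omega>)))"
      by (auto intro!: sets_pair_measure_cong)
  next
    fix A B assume "A \<in> sets (distr M1 (history_space N t) H)" "B \<in> sets (D i)"
    then have AB[measurable]: "A \<in> sets (history_space N t)" "B \<in> sets borel"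
      by auto
    have "emeasure (distr M1 (history_space N t) H) A = prob {\<omega>\<in>space M. H \<omega> \<in> A \<and> a t \<omega> = i}"
      by (auto simp: emeasure_distr event emeasure_eq_measure
          intro!: arg_cong[where f = prob])
    moreover have "emeasure (distr M1 (history_space N t \<Otimes>\<^sub>M borel) (\<lambda>\<omega>. (H \<omega>, X t \<omega>))) (A \<times> B)
        = prob {\<omega>\<in>space M. H \<omega> \<in> A \<and> a t \<omega> = i \<and> X t \<omega> \<in> B}"
      by (auto simp: emeasure_distr event emeasure_eq_measure
          intro!: arg_cong[where f = prob])
    moreover have "emeasure (D i) B = measure (D i) B"
      by (simp add: D.emeasure_eq_measure)
    ultimately show "emeasure (distr M1 (history_space N t) H) A * emeasure (D i) B =
      emeasure (distr M1 (history_space N t \<Otimes>\<^sub>M borel) (\<lambda>\<omega>. (H \<omega>, X t \<omega>))) (A \<times> B)"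
      using reward_law[OF t i AB]
      by (simp add: H_def flip: ennreal_mult)
  qed
  then have "(\<integral>\<^sup>+z. f (fst z) * g (snd z) \<partial>(distr M1 (history_space N t) H \<Otimes>\<^sub>M D i)) =
     (\<integral>\<^sup>+z. f (fst z) * g (snd z) \<partial>distr M1 (history_space N t \<Otimes>\<^sub>M borel) (\<lambda>\<omega>. (H \<omega>, X t \<omega>)))"
    by simp
  also have "\<dots> = (\<integral>\<^sup>+\<omega>. f (H \<omega>) * g (X t \<omega>) \<partial>M1)"
    by (subst nn_integral_distr) auto
  also have "\<dots> = (\<integral>\<^sup>+\<omega>. f (H \<omega>) * indicator {i} (a t \<omega>) * g (X t \<omega>) \<partial>M)"
    unfolding M1_def by (subst nn_integral_density) (auto simp: ac_simps)
  finally have "(\<integral>\<^sup>+\<omega>. f (H \<omega>) * indicator {i} (a t \<omega>) * g (X t \<omega>) \<partial>M) =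
      (\<integral>\<^sup>+z. f (fst z) * g (snd z) \<partial>(distr M1 (history_space N t) H \<Otimes>\<^sub>M D i))" ..
  also have "\<dots> = (\<integral>\<^sup>+h. \<integral>\<^sup>+x. f h * g x \<partial>D i \<partial>distr M1 (history_space N t) H)"
    by (subst D.nn_integral_fst[symmetric]) auto
  also have "\<dots> = (\<integral>\<^sup>+h. f h * (\<integral>\<^sup>+x. g x \<partial>D i) \<partial>distr M1 (history_space N t) H)"
    by (intro nn_integral_cong nn_integral_cmult) auto
  also have "\<dots> = (\<integral>\<^sup>+h. f h \<partial>distr M1 (history_space N t) H) * (\<integral>\<^sup>+x. g x \<partial>D i)"
    by (rule nn_integral_multc) auto
  also have "(\<integral>\<^sup>+h. f h \<partial>distr M1 (history_space N t) H) = (\<integral>\<^sup>+\<omega>. f (H \<omega>) * indicator {i} (a t \<omega>) \<partial>M)"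
    unfolding M1_def by (subst nn_integral_distr) (auto simp: nn_integral_density ac_simps)
  finally show ?thesis
    by (simp add: H_def)
qed

lemma nn_integral_by_action:
  assumes t: "t \<ge> 1" and f: "f \<in> borel_measurable M"
  shows "(\<integral>\<^sup>+\<omega>. f \<omega> \<partial>M) = (\<Sum>i\<in>{1..N}. \<integral>\<^sup>+\<omega>. f \<omega> * indicator {i} (a t \<omega>) \<partial>M)"
proof -
  note [measurable] = action_measurable[OF t] f
  have "(\<Sum>i\<in>{1..N}. \<integral>\<^sup>+\<omega>. f \<omega> * indicator {i} (a t \<omega>) \<partial>M)
      = (\<integral>\<^sup>+\<omega>. (\<Sum>i\<in>{1..N}. f \<omega> * indicator {i} (a t \<omega>)) \<partial>M)"
    using measurable_indicator_action[OF t] by (subst nn_integral_sum) auto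
  also have "\<dots> = (\<integral>\<^sup>+\<omega>. f \<omega> \<partial>M)"
  proof (rule nn_integral_cong)
    fix \<omega> assume "\<omega> \<in> space M"
    then have "a t \<omega> \<in> {1..N}"
      using measurable_space[OF action_measurable[OF t]] by simp
    then show "(\<Sum>i\<in>{1..N}. f \<omega> * indicator {i} (a t \<omega>)) = f \<omega>"
      by (simp add: indicator_def)
  qed
  finally show ?thesis ..
qed

lemma nn_integral_action:
  assumes "t \<ge> 1" "i \<in> {1..N}"
  shows "(\<integral>\<^sup>+\<omega>. indicator {i} (a t \<omega>) \<partial>M) = prob {\<omega>\<in>space M. a t \<omega> = i}"
proof -
  have "(\<integral>\<^sup>+\<omega>. indicator {i} (a t \<omega>) \<partial>M) = (\<integral>\<^sup>+\<omega>. indicator {\<omega>\<in>space M. a t \<omega> = i} \<omega> \<partial>M)"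
    by (auto intro!: nn_integral_cong split: split_indicator)
  also have "\<dots> = emeasure M {\<omega>\<in>space M. a t \<omega> = i}"
    using action_measurable[OF assms(1)] assms(2)
    by (intro nn_integral_indicator) measurable
  finally show ?thesis
    by (simp add: emeasure_eq_measure)
qed

text \<open>The one-step identity with a constant function of the history, summed over the actions:
  the law of an observed reward is a mixture of the arm laws.\<close>

lemma nn_integral_reward:
  assumes t: "t \<ge> 1" and g: "g \<in> borel_measurable borel"
  shows "(\<integral>\<^sup>+\<omega>. g (X t \<omega>) \<partial>M) =
    (\<Sum>i\<in>{1..N}. prob {\<omega>\<in>space M. a t \<omega> = i} * (\<integral>\<^sup>+x. g x \<partial>D i))"
proof -
  note [measurable] = reward_measurable[OF t] g
  have "(\<integral>\<^sup>+\<omega>. g (X t \<omega>) \<partial>M) =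
      (\<Sum>i\<in>{1..N}. \<integral>\<^sup>+\<omega>. 1 * indicator {i} (a t \<omega>) * g (X t \<omega>) \<partial>M)"
    by (subst nn_integral_by_action[OF t]) (auto simp: ac_simps)
  also have "\<dots> = (\<Sum>i\<in>{1..N}. (\<integral>\<^sup>+\<omega>. 1 * indicator {i} (a t \<omega>) \<partial>M) * (\<integral>\<^sup>+x. g x \<partial>D i))"
    by (intro sum.cong refl nn_integral_reward_step[OF t]) auto
  finally show ?thesis
    by (simp add: nn_integral_action[OF t])
qed

lemma AE_reward_bounded:
  assumes t: "t \<ge> 1"
  shows "AE \<omega> in M. X t \<omega> \<in> {0..1}"
proof -
  note [measurable] = reward_measurable[OF t]
  have "(\<integral>\<^sup>+\<omega>. indicator (- {0..1}) (X t \<omega>) \<partial>M) = (\<Sum>i\<in>{1..N}. prob {\<omega>\<in>space M. a t \<omega> = i} *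
      (\<integral>\<^sup>+x. indicator (- {0..1}) x \<partial>D i))"
    by (rule nn_integral_reward[OF t]) simp
  also have "\<dots> = 0"
  proof (rule sum.neutral, rule ballI)
    fix i assume i: "i \<in> {1..N}"
    have "(\<integral>\<^sup>+x. indicator (- {0..1::real}) x \<partial>D i) = (\<integral>\<^sup>+x. 0 \<partial>D i)"
      by (rule nn_integral_cong_AE) (use reward_bounded[OF i] in eventually_elim, simp)
    then show "prob {\<omega>\<in>space M. a t \<omega> = i} * (\<integral>\<^sup>+x. indicator (- {0..1::real}) x \<partial>D i) = 0"
      by simp
  qed
  finally have "AE \<omega> in M. indicator (- {0..1}) (X t \<omega>) = (0 :: ennreal)"
    by (subst (asm) nn_integral_0_iff_AE) auto
  then show ?thesis
    by eventually_elim (simp split: split_indicator_asm)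
qed

lemma integrable_reward:
  assumes t: "t \<ge> 1"
  shows "integrable M (X t)"
  by (rule integrable_const_bound[where B = 1])
    (use AE_reward_bounded[OF t] reward_measurable[OF t] in auto)

lemma arm_mean_nn_integral:
  assumes i: "i \<in> {1..N}"
  shows "(\<integral>\<^sup>+x. ennreal x \<partial>D i) = ennreal (arm_mean D i)" and arm_mean_bounded: "arm_mean D i \<in> {0..1}"
proof -
  interpret D: prob_space "D i" by (rule reward_space[OF i])
  have [measurable_cong]: "sets (D i) = sets borel" by (rule sets_reward[OF i])
  have int: "integrable (D i) (\<lambda>x. x)"
    by (rule D.integrable_const_bound[where B = 1]) (use reward_bounded[OF i] in auto)
  show "(\<integral>\<^sup>+x. ennreal x \<partial>D i) = ennreal (arm_mean D i)"
    unfolding arm_mean_def by (rule nn_integral_eq_integral[OF int]) (use reward_bounded[OF i] in auto)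
  show "arm_mean D i \<in> {0..1}"
    unfolding arm_mean_def
    using D.integral_ge_const[OF int, of 0] D.integral_le_const[OF int, of 1] reward_bounded[OF i]
    by auto
qed

lemma expectation_reward:
  assumes t: "t \<ge> 1"
  shows "expectation (X t) = (\<Sum>i\<in>{1..N}. prob {\<omega>\<in>space M. a t \<omega> = i} * arm_mean D i)"
proof -
  have "ennreal (expectation (X t)) = (\<integral>\<^sup>+\<omega>. ennreal (X t \<omega>) \<partial>M)"
    by (rule nn_integral_eq_integral[symmetric, OF integrable_reward[OF t]])
      (use AE_reward_bounded[OF t] in auto)
  also have "\<dots> = (\<Sum>i\<in>{1..N}. ennreal (prob {\<omega>\<in>space M. a t \<omega> = i} * arm_mean D i))"
    by (subst nn_integral_reward[OF t]) (auto simp: arm_mean_nn_integral ennreal_mult')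
  also have "\<dots> = ennreal (\<Sum>i\<in>{1..N}. prob {\<omega>\<in>space M. a t \<omega> = i} * arm_mean D i)"
    using arm_mean_bounded by (intro sum_ennreal) auto
  finally show ?thesis
    using arm_mean_bounded AE_reward_bounded[OF t]
    by (subst (asm) ennreal_inj) (auto intro!: integral_nonneg_AE sum_nonneg)
qed

lemma prob_actions:
  assumes t: "t \<ge> 1"
  shows "(\<Sum>i\<in>{1..N}. prob {\<omega>\<in>space M. a t \<omega> = i}) = 1"
proof -
  have "1 = (\<Sum>i\<in>{1..N}. ennreal (prob {\<omega>\<in>space M. a t \<omega> = i}))"
    using nn_integral_by_action[OF t, of "\<lambda>_. 1"] nn_integral_action[OF t]
    by (simp add: emeasure_space_1)
  then show ?thesis
    by (subst (asm) sum_ennreal) (auto simp: ennreal_eq_1 dest: sym)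
qed

section \<open>Regret in terms of action probabilities\<close>

lemma expected_total_reward_eq:
  "expected_total_reward M X T =
    (\<Sum>t\<in>{1..T}. \<Sum>i\<in>{1..N}. prob {\<omega>\<in>space M. a t \<omega> = i} * arm_mean D i)"
  unfolding expected_total_reward_def
  by (subst Bochner_Integration.integral_sum) (auto simp: integrable_reward expectation_reward)

text \<open>The action probabilities of a step add up to 1, so the optimal mean can be moved inside
  the sum over arms. Every summand is then nonnegative, which bounds all policies at once.\<close>

lemma regret_eq:
  "regret N D M X T =
    (\<Sum>t\<in>{1..T}. \<Sum>i\<in>{1..N}. prob {\<omega>\<in>space M. a t \<omega> = i} * (optimal_mean N D - arm_mean D i))"
proof -
  have "(\<Sum>t\<in>{1..T}. \<Sum>i\<in>{1..N}. prob {\<omega>\<in>space M. a t \<omega> = i} * (optimal_mean N D - arm_mean D i)) =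
      (\<Sum>t\<in>{1..T}. optimal_mean N D - (\<Sum>i\<in>{1..N}. prob {\<omega>\<in>space M. a t \<omega> = i} * arm_mean D i))"
    using prob_actions
    by (intro sum.cong refl) (simp add: right_diff_distrib sum_subtractf flip: sum_distrib_right)
  then show ?thesis
    by (simp add: regret_def expected_total_reward_eq sum_subtractf)
qed

lemma regret_nonneg: "regret N D M X T \<ge> 0"
  unfolding regret_eq optimal_mean_def by (intro sum_nonneg mult_nonneg_nonneg) auto

section \<open>Concentration of the rewards of one arm\<close>

lemma centered_mgf_le:
  assumes i: "i \<in> {1..N}"
  shows "(\<integral>\<^sup>+x. ennreal (exp (c * (x - arm_mean D i))) \<partial>D i) \<le> ennreal (exp (c\<^sup>2 / 8))"
proof -
  interpret D: prob_space "D i" by (rule reward_space[OF i])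
  have [measurable_cong]: "sets (D i) = sets borel" by (rule sets_reward[OF i])
  note AE = reward_bounded[OF i]
  consider "c = 0" | "c > 0" | "c < 0" by linarith
  then show ?thesis
  proof cases
    case 1
    then show ?thesis by (simp add: D.emeasure_space_1)
  next
    case 2
    interpret interval_bounded_random_variable "D i" "\<lambda>x. x" 0 1
      by unfold_locales (use AE in auto)
    show ?thesis
      using Hoeffdings_lemma_nn_integral[OF 2] by (simp add: arm_mean_def)
  next
    case 3
    \<comment> \<open>Negative \<open>c\<close> is reduced to positive \<open>- c\<close> by
      reflecting the reward.\<close>
    interpret interval_bounded_random_variable "D i" "\<lambda>x. - x" "-1" 0
      by unfold_locales (use AE in auto)
    show ?thesis
      using Hoeffdings_lemma_nn_integral[of "- c"] 3 by (simp add: arm_mean_def algebra_simps)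
  qed
qed

text \<open>The compensated exponential is a supermartingale: a step only changes it when arm \<open>i\<close> is
  played, and then Hoeffding's lemma absorbs the factor.\<close>

lemma exp_deviation_le_1:
  assumes i: "i \<in> {1..N}" and "t \<ge> 1"
  shows "(\<integral>\<^sup>+\<omega>. ennreal (exp (c * reward_deviation a X i (arm_mean D i) t \<omega>
    - c\<^sup>2 / 8 * num_plays a i t \<omega>)) \<partial>M) \<le> 1"
  using \<open>t \<ge> 1\<close>
proof (induction t rule: nat_induct_at_least)
  case base
  then show ?case
    by (simp add: reward_deviation_def real_num_plays emeasure_space_1)
next
  case (Suc t)
  define W where "W t \<omega> = ennreal (exp (c * reward_deviation a X i (arm_mean D i) t \<omega>
    - c\<^sup>2 / 8 * num_plays a i t \<omega>))" for t \<omega>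
  define g where "g x = ennreal (exp (c * (x - arm_mean D i) - c\<^sup>2 / 8))" for x
  \<comment> \<open>The value before step \<open>t\<close> rewritten as a function of the history,
    the form that \<open>nn_integral_reward_step\<close> requires.\<close>
  define f where "f h = ennreal (exp (c * (\<Sum>l\<in>{1..<t}. of_bool (fst (h l) = i) * (snd (h l) - arm_mean D i))
    - c\<^sup>2 / 8 * (\<Sum>l\<in>{1..<t}. of_bool (fst (h l) = i))))" for h :: "nat \<Rightarrow> nat \<times> real"
  have [measurable]: "(\<lambda>h. h l) \<in> history_space N t \<rightarrow>\<^sub>M count_space {1..N} \<Otimes>\<^sub>M borel" if "l \<in> {1..<t}" for l
    unfolding history_space_def using that by (rule measurable_component_singleton)
  have [measurable]: "{i} \<in> sets (count_space {1..N})"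
    using i by simp
  have of_bool_fst: "of_bool (fst (h l) = i) = (indicator {i} (fst (h l)) :: real)" for h :: "nat \<Rightarrow> nat \<times> real" and l
    by simp
  have f[measurable]: "f \<in> borel_measurable (history_space N t)"
    unfolding f_def of_bool_fst by measurable
  have g[measurable]: "g \<in> borel_measurable borel"
    unfolding g_def by measurable
  note [measurable] = history_measurable[OF \<open>t \<ge> 1\<close>] action_measurable[OF \<open>t \<ge> 1\<close>]
    reward_measurable[OF \<open>t \<ge> 1\<close>]
  have Wf: "W t \<omega> = f (history a X t \<omega>)" for \<omega>
    by (simp add: W_def f_def history_def real_num_plays reward_deviation_def)
  note ind = measurable_indicator_action[OF \<open>t \<ge> 1\<close>]
  \<comment> \<open>Localized to one action, the new value is the old one times a factor that
    depends on the fresh reward only.\<close>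
  have step: "W (Suc t) \<omega> * indicator {j} (a t \<omega>) =
      W t \<omega> * indicator {j} (a t \<omega>) * (if j = i then g (X t \<omega>) else 1)" for \<omega> j
    using \<open>t \<ge> 1\<close>
    by (auto simp: W_def g_def num_plays_Suc reward_deviation_Suc algebra_simps
        split: split_indicator simp flip: ennreal_mult exp_add)
  have "(\<integral>\<^sup>+x. g x \<partial>D i) \<le> 1"
  proof -
    have [measurable_cong]: "sets (D i) = sets borel" by (rule sets_reward[OF i])
    have "(\<integral>\<^sup>+x. g x \<partial>D i) = ennreal (exp (- (c\<^sup>2 / 8))) * (\<integral>\<^sup>+x. ennreal (exp (c * (x - arm_mean D i))) \<partial>D i)"
      by (subst nn_integral_cmult[symmetric]) (auto simp: g_def[abs_def] simp flip: ennreal_mult exp_add)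
    also have "\<dots> \<le> ennreal (exp (- (c\<^sup>2 / 8))) * ennreal (exp (c\<^sup>2 / 8))"
      by (intro mult_left_mono centered_mgf_le[OF i]) auto
    finally show ?thesis
      by (simp flip: ennreal_mult exp_add)
  qed
  note g_le = this
  have "(\<integral>\<^sup>+\<omega>. W (Suc t) \<omega> * indicator {j} (a t \<omega>) \<partial>M) \<le> (\<integral>\<^sup>+\<omega>. W t \<omega> * indicator {j} (a t \<omega>) \<partial>M)"
    if j: "j \<in> {1..N}" for j
  proof (cases "j = i")
    case True
    have "(\<integral>\<^sup>+\<omega>. W (Suc t) \<omega> * indicator {i} (a t \<omega>) \<partial>M) =
        (\<integral>\<^sup>+\<omega>. f (history a X t \<omega>) * indicator {i} (a t \<omega>) * g (X t \<omega>) \<partial>M)"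
      by (simp only: step Wf if_True refl)
    also have "\<dots> = (\<integral>\<^sup>+\<omega>. f (history a X t \<omega>) * indicator {i} (a t \<omega>) \<partial>M) * (\<integral>\<^sup>+x. g x \<partial>D i)"
      by (rule nn_integral_reward_step[OF \<open>t \<ge> 1\<close> i f g])
    also have "\<dots> \<le> (\<integral>\<^sup>+\<omega>. f (history a X t \<omega>) * indicator {i} (a t \<omega>) \<partial>M)"
      using mult_left_mono[OF g_le] by force
    finally show ?thesis
      using True by (simp add: Wf)
  next
    case False
    then show ?thesis
      by (simp only: step if_False mult_1_right)
  qed
  \<comment> \<open>At time \<open>Suc t\<close> measurability is read off from the same
    decomposition by actions.\<close>
  moreover have W_meas: "W s \<in> borel_measurable M" if "s = t \<or> s = Suc t" for s
  proof -
    have eq: "W (Suc t) \<omega> = (\<Sum>j\<in>{1..N}. f (history a X t \<omega>) * indicator {j} (a t \<omega>) *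
      (if j = i then g (X t \<omega>) else 1))" if "\<omega> \<in> space M" for \<omega>
    proof -
      have "a t \<omega> \<in> {1..N}"
        using measurable_space[OF action_measurable[OF \<open>t \<ge> 1\<close>] that] by simp
      then have "W (Suc t) \<omega> = (\<Sum>j\<in>{1..N}. W (Suc t) \<omega> * indicator {j} (a t \<omega>))"
        by (simp add: indicator_def)
      then show ?thesis
        by (simp only: step Wf)
    qed
    have "(\<lambda>\<omega>. \<Sum>j\<in>{1..N}. f (history a X t \<omega>) * indicator {j} (a t \<omega>) *
      (if j = i then g (X t \<omega>) else 1)) \<in> borel_measurable M"
      using ind by measurable
    then have "W (Suc t) \<in> borel_measurable M"
      using eq by (subst measurable_cong) auto
    moreover have "W t \<in> borel_measurable M"
      unfolding Wf by measurable
    ultimately show ?thesis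
      using that by auto
  qed
  ultimately have "(\<integral>\<^sup>+\<omega>. W (Suc t) \<omega> \<partial>M) \<le> (\<integral>\<^sup>+\<omega>. W t \<omega> \<partial>M)"
    by (subst (1 2) nn_integral_by_action[OF \<open>t \<ge> 1\<close>]) (auto intro: sum_mono)
  also have "\<dots> \<le> 1"
    using Suc.IH by (simp add: W_def)
  finally show ?case
    by (simp add: W_def)
qed

lemma measurable_num_plays:
  assumes "i \<in> {1..N}"
  shows "(\<lambda>\<omega>. real (num_plays a i t \<omega>)) \<in> borel_measurable M"
  unfolding real_num_plays
proof (rule borel_measurable_sum)
  fix l assume "l \<in> {1..<t}"
  then have "(\<lambda>\<omega>. indicator {i} (a l \<omega>) :: real) \<in> borel_measurable M"
    by (intro measurable_compose[OF action_measurable borel_measurable_indicator]) (use assms in auto)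
  then show "(\<lambda>\<omega>. of_bool (a l \<omega> = i) :: real) \<in> borel_measurable M"
    by (simp add: indicator_def)
qed

lemma measurable_reward_deviation:
  assumes "i \<in> {1..N}"
  shows "reward_deviation a X i \<mu> t \<in> borel_measurable M"
  unfolding reward_deviation_def
proof (rule borel_measurable_sum)
  fix l assume l: "l \<in> {1..<t}"
  then have "(\<lambda>\<omega>. indicator {i} (a l \<omega>) :: real) \<in> borel_measurable M"
    by (intro measurable_compose[OF action_measurable borel_measurable_indicator]) (use assms in auto)
  then have "(\<lambda>\<omega>. of_bool (a l \<omega> = i) :: real) \<in> borel_measurable M"
    by (simp add: indicator_def)
  then show "(\<lambda>\<omega>. of_bool (a l \<omega> = i) * (X l \<omega> - \<mu>)) \<in> borel_measurable M"
    using reward_measurable[of l] l by simp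
qed

text \<open>Where the deviation is at least \<delta> per play, the supermartingale with a suitable
  \<open>c\<close> is at least exp of \<open>2 * \<delta>\<^sup>2\<close> times the play count. The
  restriction to at least \<open>K\<close> plays turns this into a deterministic lower bound, and
  the expectation bound 1 yields the tail as in Markov's inequality. Both signs give the factor
  2.\<close>

lemma deviation_tail:
  fixes \<delta> :: real and K :: nat
  assumes i: "i \<in> {1..N}" and t: "t \<ge> 1" and "\<delta> > 0"
  shows "prob {\<omega>\<in>space M. K \<le> num_plays a i t \<omega> \<and>
      \<delta> * num_plays a i t \<omega> \<le> \<bar>reward_deviation a X i (arm_mean D i) t \<omega>\<bar>} \<le> 2 * exp (- 2 * \<delta>\<^sup>2 * K)"
proof -
  define k where "k \<omega> = real (num_plays a i t \<omega>)" for \<omega>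
  define S where "S = reward_deviation a X i (arm_mean D i) t"
  have [measurable]: "k \<in> borel_measurable M" "S \<in> borel_measurable M"
    using measurable_num_plays[OF i] measurable_reward_deviation[OF i] by (simp_all add: k_def[abs_def] S_def)
  have one_sided: "prob {\<omega>\<in>space M. real K \<le> k \<omega> \<and> \<delta> * k \<omega> \<le> s * S \<omega>} \<le> exp (- 2 * \<delta>\<^sup>2 * K)"
    if s: "s\<^sup>2 = 1" for s :: real
  proof -
    let ?E = "{\<omega>\<in>space M. real K \<le> k \<omega> \<and> \<delta> * k \<omega> \<le> s * S \<omega>}"
    \<comment> \<open>The exponent per play is \<open>c * \<delta> - c\<^sup>2 / 8\<close> when
      \<open>s = 1\<close>; it is largest at \<open>c = 4 * \<delta>\<close>, with value
      \<open>2 * \<delta>\<^sup>2\<close>. The sign \<open>s\<close> selects the side.\<close>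
    define c where "c = 4 * \<delta> * s"
    have "emeasure M ?E = (\<integral>\<^sup>+\<omega>. indicator ?E \<omega> \<partial>M)"
      by simp
    also have "\<dots> \<le> (\<integral>\<^sup>+\<omega>. ennreal (exp (- 2 * \<delta>\<^sup>2 * K)) * ennreal (exp (c * S \<omega> - c\<^sup>2 / 8 * k \<omega>)) \<partial>M)"
    proof (rule nn_integral_mono)
      fix \<omega>
      have "1 \<le> exp (- 2 * \<delta>\<^sup>2 * K) * exp (c * S \<omega> - c\<^sup>2 / 8 * k \<omega>)"
        if "real K \<le> k \<omega>" "\<delta> * k \<omega> \<le> s * S \<omega>"
      proof -
        have "4 * \<delta> * (\<delta> * k \<omega>) \<le> 4 * \<delta> * (s * S \<omega>)" "2 * \<delta>\<^sup>2 * K \<le> 2 * \<delta>\<^sup>2 * k \<omega>"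
          using that \<open>\<delta> > 0\<close> by (auto intro!: mult_left_mono)
        moreover have "c\<^sup>2 / 8 = 2 * \<delta>\<^sup>2"
          using s by (simp add: c_def power_mult_distrib)
        moreover have "4 * \<delta> * (\<delta> * k \<omega>) = 4 * \<delta>\<^sup>2 * k \<omega>" "4 * \<delta> * (s * S \<omega>) = c * S \<omega>"
          by (simp_all add: c_def power2_eq_square)
        ultimately have "0 \<le> - 2 * \<delta>\<^sup>2 * K + (c * S \<omega> - c\<^sup>2 / 8 * k \<omega>)"
          by simp
        then show ?thesis
          by (simp flip: exp_add)
      qed
      then show "indicator ?E \<omega> \<le> ennreal (exp (- 2 * \<delta>\<^sup>2 * K)) * ennreal (exp (c * S \<omega> - c\<^sup>2 / 8 * k \<omega>))"
        by (auto simp flip: ennreal_mult split: split_indicator)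
    qed
    also have "\<dots> = ennreal (exp (- 2 * \<delta>\<^sup>2 * K)) * (\<integral>\<^sup>+\<omega>. ennreal (exp (c * S \<omega> - c\<^sup>2 / 8 * k \<omega>)) \<partial>M)"
      by (rule nn_integral_cmult) measurable
    also have "\<dots> \<le> ennreal (exp (- 2 * \<delta>\<^sup>2 * K)) * 1"
      using exp_deviation_le_1[OF i t, of c] by (intro mult_left_mono) (simp_all add: S_def k_def)
    finally show ?thesis
      by (simp add: emeasure_eq_measure)
  qed
  have "prob {\<omega>\<in>space M. K \<le> num_plays a i t \<omega> \<and> \<delta> * num_plays a i t \<omega> \<le> \<bar>S \<omega>\<bar>} \<le>
      prob ({\<omega>\<in>space M. real K \<le> k \<omega> \<and> \<delta> * k \<omega> \<le> 1 * S \<omega>} \<union>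
        {\<omega>\<in>space M. real K \<le> k \<omega> \<and> \<delta> * k \<omega> \<le> - 1 * S \<omega>})"
  proof (rule finite_measure_mono)
    show "{\<omega>\<in>space M. K \<le> num_plays a i t \<omega> \<and> \<delta> * num_plays a i t \<omega> \<le> \<bar>S \<omega>\<bar>} \<subseteq>
        {\<omega>\<in>space M. real K \<le> k \<omega> \<and> \<delta> * k \<omega> \<le> 1 * S \<omega>} \<union>
        {\<omega>\<in>space M. real K \<le> k \<omega> \<and> \<delta> * k \<omega> \<le> - 1 * S \<omega>}"
      by (auto simp: k_def abs_if split: if_splits)
  qed measurable
  also have "\<dots> \<le> prob {\<omega>\<in>space M. real K \<le> k \<omega> \<and> \<delta> * k \<omega> \<le> 1 * S \<omega>} +
      prob {\<omega>\<in>space M. real K \<le> k \<omega> \<and> \<delta> * k \<omega> \<le> - 1 * S \<omega>}"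
    by (rule measure_Un_le) measurable
  also have "\<dots> \<le> 2 * exp (- 2 * \<delta>\<^sup>2 * K)"
    using one_sided[of 1] one_sided[of "- 1"] by simp
  finally show ?thesis
    by (simp add: S_def)
qed

end

section \<open>Independent families and Gaussian noise\<close>

lemma (in prob_space) indep_vars_prob_finite:
  assumes X: "indep_vars M' X I" and J: "finite J" "J \<subseteq> I" and E: "\<And>j. j \<in> J \<Longrightarrow> E j \<in> sets (M' j)"
  shows "prob {\<omega>\<in>space M. \<forall>j\<in>J. X j \<omega> \<in> E j} = (\<Prod>j\<in>J. prob {\<omega>\<in>space M. X j \<omega> \<in> E j})"
proof (cases "J = {}")
  case False
  have "{\<omega>\<in>space M. \<forall>j\<in>J. X j \<omega> \<in> E j} = (\<Inter>j\<in>J. X j -` E j \<inter> space M)"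
    using False by auto
  moreover have "{\<omega>\<in>space M. X j \<omega> \<in> E j} = X j -` E j \<inter> space M" for j
    by auto
  ultimately show ?thesis
    using indep_varsD[OF X False J E] by simp
qed (simp add: prob_space)

text \<open>Rewards and noise come with separate independence assumptions; one joint family is
  wanted so that it can be cut along time. A finite index set splits into its two halves:
  independence of the whole families separates the halves, and independence within each family
  factors each half.\<close>

lemma (in prob_space) indep_vars_bool_Times:
  fixes I :: "'i set"
  assumes A: "indep_vars (\<lambda>_. S) A I" and B: "indep_vars (\<lambda>_. S) B I"
    and AB: "indep_var (PiM I (\<lambda>_. S)) (\<lambda>\<omega>. \<lambda>i\<in>I. A i \<omega>) (PiM I (\<lambda>_. S)) (\<lambda>\<omega>. \<lambda>i\<in>I. B i \<omega>)"
  shows "indep_vars (\<lambda>_. S) (\<lambda>(b, i). if b then A i else B i) (UNIV \<times> I)"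
proof -
  define Y where "Y = (\<lambda>(b, i). if b then A i else B i)"
  have Y_simps[simp]: "Y (True, i) = A i" "Y (False, i) = B i" for i
    by (simp_all add: Y_def)
  have rv: "A i \<in> M \<rightarrow>\<^sub>M S" "B i \<in> M \<rightarrow>\<^sub>M S" if "i \<in> I" for i
    using A B that by (auto simp: indep_vars_def)
  have "indep_vars (\<lambda>_. S) Y (UNIV \<times> I)"
    unfolding indep_vars_def2
  proof (intro conjI ballI indep_setsI)
    fix j :: "bool \<times> 'i" assume "j \<in> UNIV \<times> I"
    then show "random_variable S (Y j)"
      by (cases j; cases "fst j") (auto simp: rv)
    then show "{Y j -` E \<inter> space M |E. E \<in> sets S} \<subseteq> events"
      by (auto intro: measurable_sets)
  next
    fix F and J :: "(bool \<times> 'i) set" assume J: "J \<noteq> {}" "J \<subseteq> UNIV \<times> I" "finite J"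
      and F: "\<forall>j\<in>J. F j \<in> {Y j -` E \<inter> space M |E. E \<in> sets S}"
    from F obtain E where E: "\<And>j. j \<in> J \<Longrightarrow> E j \<in> sets S" "\<And>j. j \<in> J \<Longrightarrow> F j = Y j -` E j \<inter> space M"
      by simp metis
    define K where "K b = {i. (b, i) \<in> J}" for b
    have K: "finite (K b)" "K b \<subseteq> I" for b
    proof -
      show "finite (K b)"
        unfolding K_def using finite_vimageI[OF J(3), of "Pair b"] by (simp add: vimage_def inj_on_def)
      show "K b \<subseteq> I"
        using J(2) by (auto simp: K_def)
    qed
    have J_eq: "J = Pair True ` K True \<union> Pair False ` K False"
    proof (intro set_eqI iffI)
      fix j assume "j \<in> J"
      then show "j \<in> Pair True ` K True \<union> Pair False ` K False"
        by (cases j; cases "fst j") (auto simp: K_def)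
    qed (auto simp: K_def)
    \<comment> \<open>A finite-dimensional condition as a cylinder over all of \<open>I\<close>,
      because \<open>AB\<close> speaks about the complete families.\<close>
    define R where "R b = {f\<in>space (PiM I (\<lambda>_. S)). \<forall>i\<in>K b. f i \<in> E (b, i)}" for b
    have R[measurable]: "R b \<in> sets (PiM I (\<lambda>_. S))" for b
      unfolding R_def
    proof (intro sets.sets_Collect_finite_All K)
      fix i assume i: "i \<in> K b"
      then have "E (b, i) \<in> sets S"
        using E by (simp add: K_def)
      moreover have "(\<lambda>f. f i) \<in> PiM I (\<lambda>_. S) \<rightarrow>\<^sub>M S"
        using i K(2)[of b] by (intro measurable_component_singleton) auto
      ultimately have "(\<lambda>f. f i) -` E (b, i) \<inter> space (PiM I (\<lambda>_. S)) \<in> sets (PiM I (\<lambda>_. S))"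
        by (rule measurable_sets[rotated])
      then show "{f \<in> space (PiM I (\<lambda>_. S)). f i \<in> E (b, i)} \<in> sets (PiM I (\<lambda>_. S))"
        by (simp add: vimage_def Int_def conj_commute)
    qed
    have sp: "(\<lambda>i\<in>I. A i \<omega>) \<in> space (PiM I (\<lambda>_. S))" "(\<lambda>i\<in>I. B i \<omega>) \<in> space (PiM I (\<lambda>_. S))"
      if "\<omega> \<in> space M" for \<omega>
      using rv[THEN measurable_space] that by (auto simp: space_PiM)
    have "(\<Inter>j\<in>J. F j) = (\<lambda>\<omega>. (\<lambda>i\<in>I. A i \<omega>, \<lambda>i\<in>I. B i \<omega>)) -` (R True \<times> R False) \<inter> space M"
    proof -
      have "(\<Inter>j\<in>J. F j) = {\<omega>\<in>space M. \<forall>j\<in>J. Y j \<omega> \<in> E j}"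
        using J(1) E(2) by auto
      also have "\<dots> = {\<omega>\<in>space M. (\<forall>i\<in>K True. A i \<omega> \<in> E (True, i)) \<and> (\<forall>i\<in>K False. B i \<omega> \<in> E (False, i))}"
        by (subst J_eq) (simp add: ball_Un)
      also have "\<dots> = (\<lambda>\<omega>. (\<lambda>i\<in>I. A i \<omega>, \<lambda>i\<in>I. B i \<omega>)) -` (R True \<times> R False) \<inter> space M"
        using K(2) sp by (auto simp: R_def subset_iff)
      finally show ?thesis .
    qed
    then have "prob (\<Inter>j\<in>J. F j) =
        prob ((\<lambda>\<omega>. \<lambda>i\<in>I. A i \<omega>) -` R True \<inter> space M) * prob ((\<lambda>\<omega>. \<lambda>i\<in>I. B i \<omega>) -` R False \<inter> space M)"
      using indep_varD[OF AB R R] by simp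
    also have "(\<lambda>\<omega>. \<lambda>i\<in>I. A i \<omega>) -` R True \<inter> space M = {\<omega>\<in>space M. \<forall>i\<in>K True. A i \<omega> \<in> E (True, i)}"
      using K(2) sp by (auto simp: R_def subset_iff)
    also have "(\<lambda>\<omega>. \<lambda>i\<in>I. B i \<omega>) -` R False \<inter> space M = {\<omega>\<in>space M. \<forall>i\<in>K False. B i \<omega> \<in> E (False, i)}"
      using K(2) sp by (auto simp: R_def subset_iff)
    also have "prob {\<omega>\<in>space M. \<forall>i\<in>K True. A i \<omega> \<in> E (True, i)} =
        (\<Prod>i\<in>K True. prob {\<omega>\<in>space M. A i \<omega> \<in> E (True, i)})"
      by (rule indep_vars_prob_finite[OF A K]) (auto simp: K_def E)
    also have "prob {\<omega>\<in>space M. \<forall>i\<in>K False. B i \<omega> \<in> E (False, i)} =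
        (\<Prod>i\<in>K False. prob {\<omega>\<in>space M. B i \<omega> \<in> E (False, i)})"
      by (rule indep_vars_prob_finite[OF B K]) (auto simp: K_def E)
    also have "(\<Prod>i\<in>K True. prob {\<omega>\<in>space M. A i \<omega> \<in> E (True, i)}) *
        (\<Prod>i\<in>K False. prob {\<omega>\<in>space M. B i \<omega> \<in> E (False, i)}) =
        (\<Prod>j\<in>J. prob {\<omega>\<in>space M. Y j \<omega> \<in> E j})"
      by (subst J_eq, subst prod.union_disjoint) (auto simp: K prod.reindex inj_on_def)
    also have "\<dots> = (\<Prod>j\<in>J. prob (F j))"
      by (intro prod.cong refl arg_cong[where f = prob]) (auto simp: E(2))
    finally show "prob (\<Inter>j\<in>J. F j) = (\<Prod>j\<in>J. prob (F j))" .
  qed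
  then show ?thesis
    by (simp add: Y_def)
qed

section \<open>The Gaussian noise vector of one round\<close>

definition std_noise :: "nat \<Rightarrow> (nat \<Rightarrow> real) measure" where
  "std_noise N = PiM {1..N} (\<lambda>_. density lborel std_normal_density)"

lemma prob_space_std_normal: "prob_space (density lborel std_normal_density)"
  by (rule prob_space_normal_density) simp

lemma prob_space_std_noise: "prob_space (std_noise N)"
  unfolding std_noise_def by (intro prob_space_PiM prob_space_std_normal)

lemma sets_std_noise[measurable_cong]: "sets (std_noise N) = sets (\<Pi>\<^sub>M i\<in>{1..N}. borel)"
  unfolding std_noise_def by (intro sets_PiM_cong) auto

text \<open>Fubini with coordinate \<open>i\<close> innermost: once the other coordinates are fixed,
  a single value of \<open>z i\<close> is forbidden, and a point is null for a measure with a
  density.\<close>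

lemma AE_PiM_density_neq_affine:
  fixes f :: "real \<Rightarrow> ennreal"
  assumes f: "f \<in> borel_measurable lborel" and prob: "prob_space (density lborel f)"
    and I: "finite I" "i \<in> I" "j \<in> I" "i \<noteq> j"
  shows "AE z in PiM I (\<lambda>_. density lborel f). z i \<noteq> u + v * z j"
proof -
  define D where "D = density lborel f"
  interpret D: prob_space D
    using prob by (simp add: D_def)
  interpret product_sigma_finite "\<lambda>_. D"
    by unfold_locales
  have [measurable_cong]: "sets D = sets borel"
    by (simp add: D_def)
  define I' where "I' = I - {i}"
  have I': "I = insert i I'" "i \<notin> I'" "finite I'" "j \<in> I'"
    using I by (auto simp: I'_def)
  have [measurable]: "(\<lambda>z. z i) \<in> borel_measurable (PiM I (\<lambda>_. D))" "(\<lambda>z. z j) \<in> borel_measurable (PiM I (\<lambda>_. D))"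
    using I by (auto intro!: measurable_component_singleton simp: cong: measurable_cong_sets)
  have "(\<integral>\<^sup>+z. indicator {z\<in>space (PiM I (\<lambda>_. D)). z i = u + v * z j} z \<partial>PiM I (\<lambda>_. D)) =
      (\<integral>\<^sup>+x. (\<integral>\<^sup>+y. indicator {z\<in>space (PiM I (\<lambda>_. D)). z i = u + v * z j} (x(i := y)) \<partial>D) \<partial>PiM I' (\<lambda>_. D))"
    unfolding I'(1) by (rule product_nn_integral_insert) (use I' in \<open>auto simp flip: I'(1)\<close>)
  also have "\<dots> = (\<integral>\<^sup>+x. 0 \<partial>PiM I' (\<lambda>_. D))"
  proof (rule nn_integral_cong)
    fix x
    have "(\<integral>\<^sup>+y. indicator {z\<in>space (PiM I (\<lambda>_. D)). z i = u + v * z j} (x(i := y)) \<partial>D) \<le>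
        (\<integral>\<^sup>+y. indicator {u + v * x j} y \<partial>D)"
      using I(4) by (intro nn_integral_mono) (auto split: split_indicator)
    also have "\<dots> = emeasure D {u + v * x j}"
      by simp
    also have "\<dots> = 0"
    proof -
      have "AE y in D. y \<noteq> u + v * x j"
        unfolding D_def using AE_lborel_singleton[of "u + v * x j"] by (subst AE_density[OF f]) auto
      then show ?thesis
        by (subst (asm) AE_iff_measurable[of "{u + v * x j}"]) (auto simp: D_def)
    qed
    finally show "(\<integral>\<^sup>+y. indicator {z\<in>space (PiM I (\<lambda>_. D)). z i = u + v * z j} (x(i := y)) \<partial>D) = 0"
      by simp
  qed
  finally have "emeasure (PiM I (\<lambda>_. D)) {z\<in>space (PiM I (\<lambda>_. D)). z i = u + v * z j} = 0"
    by (subst (asm) nn_integral_indicator) auto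
  then show ?thesis
    unfolding D_def[symmetric] by (subst AE_iff_measurable[OF _ refl]) auto
qed

section \<open>The QCARE choice as a function of history and noise\<close>

text \<open>The QCARE index is evaluated on the probability space of histories itself, with the noise
  vector \<open>z\<close> as a parameter.\<close>

definition history_index :: "real \<Rightarrow> nat \<Rightarrow> nat \<Rightarrow> (nat \<Rightarrow> nat \<times> real) \<Rightarrow> (nat \<Rightarrow> real) \<Rightarrow> real" where
  "history_index \<alpha> t i h z = qcare_index \<alpha> (\<lambda>_ l h. snd (h l)) (\<lambda>i _ _. z i) (\<lambda>l h. fst (h l)) i t h"

text \<open>\<open>LEAST\<close> fixes one measurable tie-breaking rule. The rule of the actual run
  may be different, but the two can disagree only at a tie.\<close>

definition qcare_choice :: "nat \<Rightarrow> real \<Rightarrow> nat \<Rightarrow> (nat \<Rightarrow> nat \<times> real) \<Rightarrow> (nat \<Rightarrow> real) \<Rightarrow> nat" where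
  "qcare_choice N \<alpha> t h z =
    (LEAST i. i \<in> {1..N} \<and> (\<forall>j\<in>{1..N}. history_index \<alpha> t j h z \<le> history_index \<alpha> t i h z))"

text \<open>A history stores the reward of the played arm only. The index of arm \<open>i\<close>
  reads it just at the times when \<open>i\<close> was played, where it equals
  \<open>r i l\<close>.\<close>

lemma history_index_history:
  assumes "i \<in> {1..N}"
  shows "history_index \<alpha> t i (history a (observed_reward r a) t \<omega>) (\<lambda>i\<in>{1..N}. \<epsilon> i t \<omega>) =
    qcare_index \<alpha> r \<epsilon> a i t \<omega>"
proof -
  let ?h = "history a (observed_reward r a) t \<omega>"
  have plays: "{l\<in>{1..<t}. fst (?h l) = i} = {l\<in>{1..<t}. a l \<omega> = i}"
    by (auto simp: history_def)
  have "(\<Sum>l\<in>{l\<in>{1..<t}. a l \<omega> = i}. snd (?h l)) = (\<Sum>l\<in>{l\<in>{1..<t}. a l \<omega> = i}. r i l \<omega>)"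
    by (rule sum.cong) (auto simp: history_def observed_reward_def)
  then show ?thesis
    unfolding history_index_def qcare_index_def emp_mean_def num_plays_def plays using assms by simp
qed

lemma AE_std_noise_inj_history_index:
  "AE z in std_noise N. inj_on (\<lambda>i. history_index \<alpha> t i h z) {1..N}"
proof -
  define m where "m i = emp_mean (\<lambda>_ l h. snd (h l)) (\<lambda>l h. fst (h l)) i t h" for i
  define c where "c i = (real (num_plays (\<lambda>l h. fst (h l)) i t h) + 1) powr \<alpha>" for i
  have c: "c i > 0" for i
    by (simp add: c_def)
  have idx: "history_index \<alpha> t i h z = m i + z i / c i" for i z
    by (simp add: history_index_def qcare_index_def m_def c_def)
  \<comment> \<open>The equation \<open>m i + z i / c i = m j + z j / c j\<close> of a tie, solved
    for \<open>z i\<close>.\<close>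
  have "AE z in std_noise N. \<forall>i\<in>{1..N}. \<forall>j\<in>{1..N}. i \<noteq> j \<longrightarrow> z i \<noteq> c i * (m j - m i) + c i / c j * z j"
    unfolding std_noise_def
    by (intro AE_finite_allI AE_impI AE_PiM_density_neq_affine prob_space_std_normal)
      (auto simp: normal_density_def[abs_def])
  then show ?thesis
  proof eventually_elim
    case (elim z)
    show ?case
    proof (rule inj_onI, rule ccontr)
      fix i j assume ij: "i \<in> {1..N}" "j \<in> {1..N}" "i \<noteq> j"
        and "history_index \<alpha> t i h z = history_index \<alpha> t j h z"
      then have "z i = c i * (m j - m i) + c i / c j * z j"
        using c[of i] c[of j] by (simp add: idx field_simps)
      with elim ij show False
        by blast
    qed
  qed
qed

lemma measurable_history_fst:
  "l \<in> {1..<t} \<Longrightarrow> (\<lambda>h. fst (h l)) \<in> history_space N t \<rightarrow>\<^sub>M count_space {1..N}"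
  and measurable_history_snd: "l \<in> {1..<t} \<Longrightarrow> (\<lambda>h. snd (h l)) \<in> borel_measurable (history_space N t)"
  unfolding history_space_def by measurable

lemma measurable_history_index:
  assumes i: "i \<in> {1..N}"
  shows "(\<lambda>x. history_index \<alpha> t i (fst x) (snd x)) \<in>
    borel_measurable (history_space N t \<Otimes>\<^sub>M (\<Pi>\<^sub>M i\<in>{1..N}. borel))"
proof -
  let ?P = "\<lambda>h l. of_bool (fst (h l) = i) :: real"
  have P: "(\<lambda>h. ?P h l) \<in> borel_measurable (history_space N t)" if "l \<in> {1..<t}" for l
  proof -
    have "(\<lambda>h. indicator {i} (fst (h l)) :: real) \<in> borel_measurable (history_space N t)"
      by (rule measurable_compose[OF measurable_history_fst[OF that] borel_measurable_indicator]) (use i in auto)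
    then show ?thesis
      by (simp add: indicator_def)
  qed
  have [measurable]: "(\<lambda>h. \<Sum>l\<in>{1..<t}. ?P h l) \<in> borel_measurable (history_space N t)"
    "(\<lambda>h. \<Sum>l\<in>{1..<t}. ?P h l * snd (h l)) \<in> borel_measurable (history_space N t)"
    by (intro borel_measurable_sum borel_measurable_times P measurable_history_snd; assumption)+
  have [measurable]: "(\<lambda>z. z i) \<in> borel_measurable (\<Pi>\<^sub>M i\<in>{1..N}. borel :: real measure)"
    using i by (rule measurable_component_singleton)
  have sum_eq: "(\<Sum>l\<in>{l\<in>{1..<t}. fst (h l) = i}. snd (h l)) = (\<Sum>l\<in>{1..<t}. ?P h l * snd (h l))"
    for h :: "nat \<Rightarrow> nat \<times> real"
    by (rule sum.mono_neutral_cong_left) auto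
  show ?thesis
    unfolding history_index_def qcare_index_def emp_mean_def real_num_plays sum_eq
    by measurable
qed

lemma qcare_choice_in:
  assumes "N > 0"
  shows "qcare_choice N \<alpha> t h z \<in> {1..N}"
    and qcare_choice_max: "j \<in> {1..N} \<Longrightarrow> history_index \<alpha> t j h z \<le> history_index \<alpha> t (qcare_choice N \<alpha> t h z) h z"
proof -
  let ?P = "\<lambda>i. i \<in> {1..N} \<and> (\<forall>j\<in>{1..N}. history_index \<alpha> t j h z \<le> history_index \<alpha> t i h z)"
  let ?J = "(\<lambda>i. history_index \<alpha> t i h z) ` {1..N}"
  have "Max ?J \<in> ?J"
    using assms by (intro Max_in) auto
  then obtain i where "i \<in> {1..N}" "history_index \<alpha> t i h z = Max ?J"
    by auto
  then have "?P i"
    by (metis Max_ge finite_atLeastAtMost finite_imageI imageI)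
  then have "?P (LEAST i. ?P i)"
    by (rule LeastI)
  then show "qcare_choice N \<alpha> t h z \<in> {1..N}"
    "j \<in> {1..N} \<Longrightarrow> history_index \<alpha> t j h z \<le> history_index \<alpha> t (qcare_choice N \<alpha> t h z) h z"
    unfolding qcare_choice_def by auto
qed

lemma qcare_choice_eqI:
  assumes "N > 0" "inj_on (\<lambda>i. history_index \<alpha> t i h z) {1..N}"
    and "is_arg_max (\<lambda>i. history_index \<alpha> t i h z) (\<lambda>i. i \<in> {1..N}) i"
  shows "qcare_choice N \<alpha> t h z = i"
proof (rule inj_onD[OF assms(2)])
  show "history_index \<alpha> t (qcare_choice N \<alpha> t h z) h z = history_index \<alpha> t i h z"
    using qcare_choice_max[OF assms(1), of i] qcare_choice_in[OF assms(1)] assms(3)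
    by (intro antisym) (auto simp: is_arg_max_linorder)
  show "qcare_choice N \<alpha> t h z \<in> {1..N}" "i \<in> {1..N}"
    using qcare_choice_in[OF assms(1)] assms(3) by (auto simp: is_arg_max_def)
qed

text \<open>Joint measurability in history and noise is what makes the law of the choice a kernel in
  the history.\<close>

lemma measurable_qcare_choice:
  assumes "N > 0"
  shows "(\<lambda>x. qcare_choice N \<alpha> t (fst x) (snd x)) \<in>
    history_space N t \<Otimes>\<^sub>M (\<Pi>\<^sub>M i\<in>{1..N}. borel) \<rightarrow>\<^sub>M count_space {1..N}"
proof -
  let ?S = "history_space N t \<Otimes>\<^sub>M (\<Pi>\<^sub>M i\<in>{1..N}. borel :: real measure)"
  have "Measurable.pred ?S (\<lambda>x. i \<in> {1..N} \<and>
      (\<forall>j\<in>{1..N}. history_index \<alpha> t j (fst x) (snd x) \<le> history_index \<alpha> t i (fst x) (snd x)))" for i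
  proof (cases "i \<in> {1..N}")
    case True
    have "Measurable.pred ?S (\<lambda>x. \<forall>j\<in>{1..N}. history_index \<alpha> t j (fst x) (snd x) \<le> history_index \<alpha> t i (fst x) (snd x))"
      using True unfolding pred_def
      by (intro sets.sets_Collect_finite_All borel_measurable_le measurable_history_index) auto
    with True show ?thesis
      by (simp only: simp_thms)
  next
    case False
    then show ?thesis
      by (simp only: simp_thms) measurable
  qed
  then have "(\<lambda>x. qcare_choice N \<alpha> t (fst x) (snd x)) \<in> ?S \<rightarrow>\<^sub>M count_space UNIV"
    unfolding qcare_choice_def
    by (rule measurable_Least[where P = "\<lambda>i x. i \<in> {1..N} \<and>
      (\<forall>j\<in>{1..N}. history_index \<alpha> t j (fst x) (snd x) \<le> history_index \<alpha> t i (fst x) (snd x))"])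
  then show ?thesis
    using qcare_choice_in[OF assms]
    by (subst measurable_count_space_eq2_countable) (auto intro: measurable_sets)
qed

section \<open>QCARE runs as runs of an admissible policy\<close>

text \<open>Serves to drop a constant component of the index: the time when the noise of one round
  is viewed as a family over arms, the tag \<open>False\<close> when noise blocks are viewed as a
  family over time.\<close>

lemma (in prob_space) indep_vars_reindex_inj:
  assumes f: "inj_on f J" and X: "indep_vars M' X (f ` J)"
  shows "indep_vars (\<lambda>j. M' (f j)) (\<lambda>j. X (f j)) J"
  unfolding indep_vars_def2
proof (intro conjI ballI indep_setsI)
  fix j assume "j \<in> J"
  then show "random_variable (M' (f j)) (X (f j))"
    using X by (auto simp: indep_vars_def)
  then show "{X (f j) -` A \<inter> space M |A. A \<in> sets (M' (f j))} \<subseteq> events"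
    by (auto intro: measurable_sets)
next
  fix A K assume K: "K \<noteq> {}" "K \<subseteq> J" "finite K"
    and A: "\<forall>j\<in>K. A j \<in> {X (f j) -` A \<inter> space M |A. A \<in> sets (M' (f j))}"
  from A obtain E where E: "\<And>j. j \<in> K \<Longrightarrow> E j \<in> sets (M' (f j))" "\<And>j. j \<in> K \<Longrightarrow> A j = X (f j) -` E j \<inter> space M"
    by simp metis
  define E' where "E' i = E (the_inv_into K f i)" for i
  have fK: "inj_on f K"
    using f K(2) by (rule inj_on_subset)
  then have E': "E' (f j) = E j" if "j \<in> K" for j
    using that by (simp add: E'_def the_inv_into_f_f)
  have "prob (\<Inter>i\<in>f ` K. X i -` E' i \<inter> space M) = (\<Prod>i\<in>f ` K. prob (X i -` E' i \<inter> space M))"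
    by (rule indep_varsD[OF X]) (use K E E' in auto)
  moreover have "(\<Inter>i\<in>f ` K. X i -` E' i \<inter> space M) = (\<Inter>j\<in>K. A j)"
    unfolding image_image by (intro INF_cong refl) (simp add: E' E(2))
  ultimately show "prob (\<Inter>j\<in>K. A j) = (\<Prod>j\<in>K. prob (A j))"
    by (simp add: prod.reindex[OF fK] E' E(2))
qed

context qcare_run
begin

abbreviation arm_space :: "(nat \<Rightarrow> real) measure" where
  "arm_space \<equiv> \<Pi>\<^sub>M i\<in>{1..N}. borel"

text \<open>The block \<open>(True, t)\<close> is the reward vector at time \<open>t\<close>, the block \<open>(False, t)\<close> the noise
  vector.\<close>

definition block :: "bool \<times> nat \<Rightarrow> 'w \<Rightarrow> nat \<Rightarrow> real" where
  "block = (\<lambda>(b, t). if b then (\<lambda>\<omega>. \<lambda>i\<in>{1..N}. r i t \<omega>) else (\<lambda>\<omega>. \<lambda>i\<in>{1..N}. \<epsilon> i t \<omega>))"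

abbreviation noise :: "nat \<Rightarrow> 'w \<Rightarrow> nat \<Rightarrow> real" where
  "noise t \<equiv> block (False, t)"

abbreviation past :: "nat \<Rightarrow> (bool \<times> nat) set" where
  "past t \<equiv> UNIV \<times> {1..<t}"

abbreviation block_space :: "(bool \<times> nat) set \<Rightarrow> (bool \<times> nat \<Rightarrow> nat \<Rightarrow> real) measure" where
  "block_space J \<equiv> \<Pi>\<^sub>M j\<in>J. arm_space"

abbreviation qcare_history :: "nat \<Rightarrow> 'w \<Rightarrow> nat \<Rightarrow> nat \<times> real" where
  "qcare_history \<equiv> history a (observed_reward r a)"

lemma block_simps: "block (True, t) \<omega> = (\<lambda>i\<in>{1..N}. r i t \<omega>)" "noise t \<omega> = (\<lambda>i\<in>{1..N}. \<epsilon> i t \<omega>)"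
  by (simp_all add: block_def)

text \<open>Whole vectors are the units since rewards of different arms in one round may be
  dependent. The scalar noise variables are grouped by time, and the joint independence of rewards
  and noise is transported along the same regrouping of indices.\<close>

lemma indep_blocks: "indep_vars (\<lambda>_. arm_space) block (UNIV \<times> {1..})"
proof -
  have noise: "indep_vars (\<lambda>_. arm_space) (\<lambda>t \<omega>. \<lambda>i\<in>{1..N}. \<epsilon> i t \<omega>) {1..}"
  proof -
    have "indep_vars (\<lambda>t. \<Pi>\<^sub>M j\<in>{1..N} \<times> {t}. borel)
        (\<lambda>t \<omega>. restrict (\<lambda>j. (case j of (i, t) \<Rightarrow> \<epsilon> i t) \<omega>) ({1..N} \<times> {t})) {1..}"
      by (rule indep_vars_restrict[OF noise_indep]) (auto simp: disjoint_family_on_def)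
    moreover have "(\<lambda>z. \<lambda>i\<in>{1..N}. z (i, t)) \<in> (\<Pi>\<^sub>M j\<in>{1..N} \<times> {t}. borel) \<rightarrow>\<^sub>M arm_space" for t :: nat
      by (intro measurable_restrict measurable_component_singleton) auto
    ultimately have "indep_vars (\<lambda>_. arm_space)
        (\<lambda>t \<omega>. (\<lambda>z. \<lambda>i\<in>{1..N}. z (i, t)) (restrict (\<lambda>j. (case j of (i, t) \<Rightarrow> \<epsilon> i t) \<omega>) ({1..N} \<times> {t}))) {1..}"
      by (rule indep_vars_compose2)
    then show ?thesis
      by (simp cong: restrict_cong)
  qed
  let ?regroup = "\<lambda>z. \<lambda>t\<in>{1..}. \<lambda>i\<in>{1..N}. z (i, t)"
  have regroup: "?regroup \<in> (\<Pi>\<^sub>M it\<in>{1..N} \<times> {1..}. borel) \<rightarrow>\<^sub>M (\<Pi>\<^sub>M t\<in>{1..}. arm_space)"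
    by (intro measurable_restrict measurable_component_singleton) auto
  have "indep_var (\<Pi>\<^sub>M t\<in>{1..}. arm_space) (\<lambda>\<omega>. \<lambda>t\<in>{1..}. \<lambda>i\<in>{1..N}. r i t \<omega>)
      (\<Pi>\<^sub>M t\<in>{1..}. arm_space) (\<lambda>\<omega>. \<lambda>t\<in>{1..}. \<lambda>i\<in>{1..N}. \<epsilon> i t \<omega>)"
    using indep_var_compose[OF reward_noise_indep regroup regroup]
    by (simp add: comp_def cong: restrict_cong)
  from indep_vars_bool_Times[OF reward_indep noise this] show ?thesis
    by (simp add: block_def if_distrib)
qed

lemma measurable_block:
  assumes "t \<ge> 1"
  shows "block (b, t) \<in> M \<rightarrow>\<^sub>M arm_space"
  using indep_blocks assms by (simp add: indep_vars_def)

lemma measurable_reward: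
  assumes "i \<in> {1..N}" "t \<ge> 1"
  shows "r i t \<in> borel_measurable M"
proof -
  have "(\<lambda>\<omega>. block (True, t) \<omega> i) \<in> borel_measurable M"
    by (rule measurable_compose[OF measurable_block measurable_component_singleton]) (use assms in auto)
  then show ?thesis
    using assms by (simp add: block_simps)
qed

lemma measurable_noise:
  assumes "i \<in> {1..N}" "t \<ge> 1"
  shows "\<epsilon> i t \<in> borel_measurable M"
  using noise_distr[OF assms] by (simp add: distributed_def)

lemma measurable_observed_reward:
  assumes "t \<ge> 1"
  shows "observed_reward r a t \<in> borel_measurable M"
  unfolding observed_reward_def[abs_def]
  by (rule measurable_compose_countable'[OF _ action_measurable]) (use assms measurable_reward in auto)

lemma measurable_qcare_history:
  shows "qcare_history t \<in> M \<rightarrow>\<^sub>M history_space N t"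
  unfolding history_def history_space_def
  by (rule measurable_restrict)
    (use action_measurable measurable_observed_reward in \<open>auto intro!: measurable_Pair\<close>)

lemma distr_noise_component:
  assumes "i \<in> {1..N}" "t \<ge> 1"
  shows "distr M borel (\<epsilon> i t) = density lborel std_normal_density"
proof -
  have "distr M borel (\<epsilon> i t) = distr M lborel (\<epsilon> i t)"
    by (rule distr_cong) auto
  then show ?thesis
    using noise_distr[OF assms] by (simp add: distributed_def)
qed

lemma distr_noise:
  assumes "N > 0" "t \<ge> 1"
  shows "distr M arm_space (noise t) = std_noise N"
proof -
  have "indep_vars (\<lambda>_. borel) (\<lambda>j. (case j of (i, t) \<Rightarrow> \<epsilon> i t)) ((\<lambda>i. (i, t)) ` {1..N})"
    by (rule indep_vars_subset[OF noise_indep]) (use assms in auto)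
  from indep_vars_reindex_inj[OF _ this] have "indep_vars (\<lambda>_. borel) (\<lambda>i. \<epsilon> i t) {1..N}"
    by (simp add: inj_on_def)
  then have "distr M arm_space (\<lambda>\<omega>. \<lambda>i\<in>{1..N}. \<epsilon> i t \<omega>) = (\<Pi>\<^sub>M i\<in>{1..N}. distr M borel (\<epsilon> i t))"
    using assms measurable_noise by (subst (asm) indep_vars_iff_distr_eq_PiM') auto
  also have "\<dots> = std_noise N"
    unfolding std_noise_def by (rule PiM_cong[OF refl distr_noise_component]) (use assms in auto)
  finally show ?thesis
    by (simp add: block_def)
qed

text \<open>The actions are only known to maximize the index, so up to tie-breaking, which may use any
  information, the history is a function of the past blocks. Hence the factorization holds almost
  surely only, and it is obtained together with the absence of ties by induction on time.\<close>

definition history_factor :: "nat \<Rightarrow> ((bool \<times> nat \<Rightarrow> nat \<Rightarrow> real) \<Rightarrow> nat \<Rightarrow> nat \<times> real) \<Rightarrow> bool" where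
  "history_factor t G \<longleftrightarrow> G \<in> block_space (past t) \<rightarrow>\<^sub>M history_space N t \<and>
    (AE \<omega> in M. qcare_history t \<omega> = G (\<lambda>j\<in>past t. block j \<omega>))"

text \<open>\<open>G\<close> reads only blocks before time \<open>t\<close>, hence is independent of
  the noise block of time \<open>t\<close>. The claim concerns laws, so an almost sure factorization
  serves as well as an equality.\<close>

lemma distr_history_noise:
  assumes N: "N > 0" and t: "t \<ge> 1" and G: "history_factor t G"
  shows "distr M (history_space N t \<Otimes>\<^sub>M arm_space) (\<lambda>\<omega>. (qcare_history t \<omega>, noise t \<omega>)) =
    distr M (history_space N t) (qcare_history t) \<Otimes>\<^sub>M std_noise N"
proof -
  let ?U = "\<lambda>\<omega>. \<lambda>j\<in>past t. block j \<omega>" and ?V = "\<lambda>\<omega>. \<lambda>j\<in>{(False, t)}. block j \<omega>"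
  let ?S = "block_space (past t)" and ?T = "block_space {(False, t)}"
  let ?f = "\<lambda>v. v (False, t)"
  have G_meas: "G \<in> ?S \<rightarrow>\<^sub>M history_space N t" and AE: "AE \<omega> in M. qcare_history t \<omega> = G (?U \<omega>)"
    using G by (auto simp: history_factor_def)
  have f_meas: "?f \<in> ?T \<rightarrow>\<^sub>M arm_space"
    by (rule measurable_component_singleton) simp
  have ind: "indep_var ?S ?U ?T ?V"
    by (rule indep_var_restrict[OF indep_blocks]) (use t in auto)
  have rv: "?U \<in> M \<rightarrow>\<^sub>M ?S" "?V \<in> M \<rightarrow>\<^sub>M ?T"
    using ind by (auto dest: indep_var_rv1 indep_var_rv2)
  have GU: "(\<lambda>\<omega>. G (?U \<omega>)) \<in> M \<rightarrow>\<^sub>M history_space N t"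
    by (rule measurable_compose[OF rv(1) G_meas])
  have distr_f: "distr (distr M ?T ?V) arm_space ?f = std_noise N"
    unfolding distr_noise[OF N t, symmetric] using distr_distr[OF f_meas rv(2)] by (simp add: comp_def)
  have distr_G: "distr (distr M ?S ?U) (history_space N t) G = distr M (history_space N t) (qcare_history t)"
  proof -
    have "distr (distr M ?S ?U) (history_space N t) G = distr M (history_space N t) (\<lambda>\<omega>. G (?U \<omega>))"
      using distr_distr[OF G_meas rv(1)] by (simp add: comp_def)
    also have "\<dots> = distr M (history_space N t) (qcare_history t)"
      by (rule distr_cong_AE) (use AE GU measurable_qcare_history in auto)
    finally show ?thesis .
  qed
  have "distr M (history_space N t \<Otimes>\<^sub>M arm_space) (\<lambda>\<omega>. (qcare_history t \<omega>, noise t \<omega>)) =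
      distr M (history_space N t \<Otimes>\<^sub>M arm_space) ((\<lambda>(u, v). (G u, ?f v)) \<circ> (\<lambda>\<omega>. (?U \<omega>, ?V \<omega>)))"
    by (rule distr_cong_AE)
      (use AE GU measurable_block[OF t] measurable_qcare_history in \<open>auto simp: comp_def intro!: measurable_Pair\<close>)
  also have "\<dots> = distr (distr M (?S \<Otimes>\<^sub>M ?T) (\<lambda>\<omega>. (?U \<omega>, ?V \<omega>))) (history_space N t \<Otimes>\<^sub>M arm_space) (\<lambda>(u, v). (G u, ?f v))"
  proof (rule distr_distr[symmetric])
    show "(\<lambda>(u, v). (G u, ?f v)) \<in> ?S \<Otimes>\<^sub>M ?T \<rightarrow>\<^sub>M history_space N t \<Otimes>\<^sub>M arm_space"
      unfolding case_prod_beta'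
      by (intro measurable_Pair measurable_compose[OF measurable_fst G_meas] measurable_compose[OF measurable_snd f_meas])
  qed (intro measurable_Pair rv)
  also have "\<dots> = distr (distr M ?S ?U \<Otimes>\<^sub>M distr M ?T ?V) (history_space N t \<Otimes>\<^sub>M arm_space) (\<lambda>(u, v). (G u, ?f v))"
    using ind by (simp only: indep_var_distribution_eq)
  also have "\<dots> = distr (distr M ?S ?U) (history_space N t) G \<Otimes>\<^sub>M distr (distr M ?T ?V) arm_space ?f"
  proof (rule pair_measure_distr[symmetric])
    show "sigma_finite_measure (distr (distr M ?T ?V) arm_space ?f)"
      unfolding distr_f using prob_space_std_noise by (simp add: prob_space_imp_sigma_finite)
  qed (use G_meas f_meas in simp_all)
  finally show ?thesis
    by (simp only: distr_f distr_G)
qed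

text \<open>For each fixed history the noise vectors that cause a tie form a null set. The product
  law lets Fubini transfer this to the random history, and without a tie the maximizer is unique,
  whatever rule the run uses.\<close>

lemma AE_action_eq_choice:
  assumes N: "N > 0" and t: "t \<ge> 1" and G: "history_factor t G"
  shows "AE \<omega> in M. a t \<omega> = qcare_choice N \<alpha> t (qcare_history t \<omega>) (noise t \<omega>)"
proof -
  interpret S: prob_space "std_noise N"
    by (rule prob_space_std_noise)
  let ?H = "distr M (history_space N t) (qcare_history t)"
  interpret H: prob_space ?H
    by (rule prob_space_distr) (rule measurable_qcare_history)
  interpret pair_sigma_finite ?H "std_noise N" ..
  let ?inj = "\<lambda>h z. inj_on (\<lambda>i. history_index \<alpha> t i h z) {1..N}"
  have eq: "?inj h z \<longleftrightarrow> (\<forall>i\<in>{1..N}. \<forall>j\<in>{1..N} - {i}. history_index \<alpha> t i h z \<noteq> history_index \<alpha> t j h z)" for h z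
    by (auto simp: inj_on_def)
  have meas: "{x\<in>space (history_space N t \<Otimes>\<^sub>M arm_space). ?inj (fst x) (snd x)}
      \<in> sets (history_space N t \<Otimes>\<^sub>M arm_space)"
    unfolding eq
    by (intro sets.sets_Collect_finite_All borel_measurable_neq measurable_history_index) auto
  have "AE x in ?H \<Otimes>\<^sub>M std_noise N. ?inj (fst x) (snd x)"
  proof (rule AE_pair_measure)
    have "sets (?H \<Otimes>\<^sub>M std_noise N) = sets (history_space N t \<Otimes>\<^sub>M arm_space)"
      by (intro sets_pair_measure_cong) (auto simp: sets_std_noise)
    moreover from this have "space (?H \<Otimes>\<^sub>M std_noise N) = space (history_space N t \<Otimes>\<^sub>M arm_space)"
      by (rule sets_eq_imp_space_eq)
    ultimately show "{x\<in>space (?H \<Otimes>\<^sub>M std_noise N). ?inj (fst x) (snd x)} \<in> sets (?H \<Otimes>\<^sub>M std_noise N)"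
      using meas by simp
    show "AE h in ?H. AE z in std_noise N. ?inj (fst (h, z)) (snd (h, z))"
      unfolding fst_conv snd_conv by (intro AE_I2 AE_std_noise_inj_history_index)
  qed
  then have "AE x in distr M (history_space N t \<Otimes>\<^sub>M arm_space) (\<lambda>\<omega>. (qcare_history t \<omega>, noise t \<omega>)).
      ?inj (fst x) (snd x)"
    by (simp only: distr_history_noise[OF assms])
  then have "AE \<omega> in M. ?inj (qcare_history t \<omega>) (noise t \<omega>)"
    by (subst (asm) AE_distr_iff)
      (use meas measurable_qcare_history measurable_block[OF t] in \<open>auto intro!: measurable_Pair\<close>)
  then show ?thesis
    using AE_space
  proof eventually_elim
    case (elim \<omega>)
    have "is_arg_max (\<lambda>i. history_index \<alpha> t i (qcare_history t \<omega>) (noise t \<omega>)) (\<lambda>i. i \<in> {1..N}) (a t \<omega>)"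
    proof -
      have "history_index \<alpha> t i (qcare_history t \<omega>) (noise t \<omega>) = qcare_index \<alpha> r \<epsilon> a i t \<omega>" if "i \<in> {1..N}" for i
        unfolding block_simps using that by (rule history_index_history)
      then show ?thesis
        using action_arg_max[OF t elim(2)] by (auto simp: is_arg_max_linorder)
    qed
    with elim(1) show ?case
      by (rule qcare_choice_eqI[OF N, symmetric])
  qed
qed

lemma history_factor_exists:
  assumes N: "N > 0" and t: "t \<ge> 1"
  shows "\<exists>G. history_factor t G"
  using t
proof (induction t rule: nat_induct_at_least)
  case base
  \<comment> \<open>The index set \<open>{1..<1}\<close> is empty, so the first history is the
    function that is \<open>undefined\<close> everywhere.\<close>
  have "history_factor 1 (\<lambda>_ _. undefined)"
    unfolding history_factor_def by (auto simp: history_def history_space_def space_PiM restrict_def)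
  then show ?case
    by (intro exI) simp
next
  case (Suc t)
  then obtain G where G: "history_factor t G"
    by blast
  then have G_meas: "G \<in> block_space (past t) \<rightarrow>\<^sub>M history_space N t"
    and G_AE: "AE \<omega> in M. qcare_history t \<omega> = G (\<lambda>j\<in>past t. block j \<omega>)"
    by (auto simp: history_factor_def)
  define P where "P y = G (restrict y (past t))" for y :: "bool \<times> nat \<Rightarrow> nat \<Rightarrow> real"
  define c where "c y = qcare_choice N \<alpha> t (P y) (y (False, t))" for y :: "bool \<times> nat \<Rightarrow> nat \<Rightarrow> real"
  \<comment> \<open>Appends at position \<open>t\<close> the choice made from the old factor and the
    current noise, together with the coordinate of the current reward block that this choice
    selects.\<close>
  define G' where "G' y = (\<lambda>l\<in>{1..<Suc t}. if l < t then P y l else (c y, y (True, t) (c y)))"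
    for y :: "bool \<times> nat \<Rightarrow> nat \<Rightarrow> real"
  let ?S = "block_space (past (Suc t))"
  have comp: "(\<lambda>y. y (b, t)) \<in> ?S \<rightarrow>\<^sub>M arm_space" for b
    using Suc by (intro measurable_component_singleton) auto
  have P: "P \<in> ?S \<rightarrow>\<^sub>M history_space N t"
    unfolding P_def by (rule measurable_compose[OF measurable_restrict_subset G_meas]) auto
  have c: "c \<in> ?S \<rightarrow>\<^sub>M count_space {1..N}"
    unfolding c_def
    using measurable_compose[OF measurable_Pair[OF P comp[of False]] measurable_qcare_choice[OF N]]
    by simp
  have "(\<lambda>y. y (True, t) i) \<in> borel_measurable ?S" if "i \<in> {1..N}" for i
    by (rule measurable_compose[OF comp measurable_component_singleton]) (rule that)
  then have rc: "(\<lambda>y. y (True, t) (c y)) \<in> borel_measurable ?S"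
    by (rule measurable_compose_countable'[OF _ c]) auto
  have "G' \<in> ?S \<rightarrow>\<^sub>M history_space N (Suc t)"
    unfolding G'_def history_space_def
  proof (rule measurable_restrict)
    fix l assume "l \<in> {1..<Suc t}"
    then consider "l < t" "l \<in> {1..<t}" | "l = t"
      by fastforce
    then show "(\<lambda>y. if l < t then P y l else (c y, y (True, t) (c y))) \<in> ?S \<rightarrow>\<^sub>M count_space {1..N} \<Otimes>\<^sub>M borel"
    proof cases
      case 1
      have "(\<lambda>y. P y l) \<in> ?S \<rightarrow>\<^sub>M count_space {1..N} \<Otimes>\<^sub>M borel"
        using P 1(2) unfolding history_space_def
        by (rule measurable_compose[OF _ measurable_component_singleton])
      with 1 show ?thesis
        by simp
    next
      case 2
      then show ?thesis
        using c rc by simp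
    qed
  qed
  moreover have "AE \<omega> in M. qcare_history (Suc t) \<omega> = G' (\<lambda>j\<in>past (Suc t). block j \<omega>)"
    using G_AE AE_action_eq_choice[OF N \<open>t \<ge> 1\<close> G]
  proof eventually_elim
    case (elim \<omega>)
    let ?y = "\<lambda>j\<in>past (Suc t). block j \<omega>"
    have "restrict ?y (past t) = (\<lambda>j\<in>past t. block j \<omega>)"
      by (rule ext) auto
    then have P_eq: "P ?y = qcare_history t \<omega>"
      using elim(1) by (simp add: P_def)
    moreover have y: "?y (b, t) = block (b, t) \<omega>" for b
      using Suc by simp
    ultimately have c_eq: "c ?y = a t \<omega>"
      unfolding c_def using elim(2) by simp
    have "a t \<omega> \<in> {1..N}"
      using elim(2) qcare_choice_in[OF N] by simp
    then have r_eq: "?y (True, t) (a t \<omega>) = observed_reward r a t \<omega>"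
      unfolding y by (simp add: block_simps observed_reward_def)
    show ?case
      unfolding G'_def P_eq c_eq r_eq by (rule ext) (auto simp: history_def less_Suc_eq)
  qed
  ultimately have "history_factor (Suc t) G'"
    by (simp add: history_factor_def)
  then show ?case
    by (intro exI) simp
qed

section \<open>The admissible policy followed by QCARE\<close>

definition qcare_policy :: "nat \<Rightarrow> (nat \<Rightarrow> nat \<times> real) \<Rightarrow> nat measure" where
  "qcare_policy t h = distr (std_noise N) (count_space {1..N}) (qcare_choice N \<alpha> t h)"

lemma admissible_qcare_policy:
  assumes N: "N > 0"
  shows "admissible_policy N qcare_policy"
  unfolding admissible_policy_def qcare_policy_def
proof (intro allI impI measurable_distr_prob_space2)
  fix t :: nat
  show "(\<lambda>h. std_noise N) \<in> history_space N t \<rightarrow>\<^sub>M prob_algebra arm_space"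
    by (rule measurable_const) (simp add: space_prob_algebra prob_space_std_noise sets_std_noise)
  show "(\<lambda>(h, z). qcare_choice N \<alpha> t h z) \<in> history_space N t \<Otimes>\<^sub>M arm_space \<rightarrow>\<^sub>M count_space {1..N}"
    using measurable_qcare_choice[OF N] by (simp add: case_prod_beta')
qed

text \<open>Almost surely the action is the choice from history and noise, whose joint law is a
  product. Integrating the noise out along slices of \<open>E\<close> leaves the kernel evaluated at
  the history.\<close>

lemma action_law:
  assumes N: "N > 0" and t: "t \<ge> 1" and i: "i \<in> {1..N}" and A: "A \<in> sets (history_space N t)"
  shows "prob {\<omega>\<in>space M. qcare_history t \<omega> \<in> A \<and> a t \<omega> = i} =
    (\<integral>\<omega>. indicator A (qcare_history t \<omega>) * measure (qcare_policy t (qcare_history t \<omega>)) {i} \<partial>M)"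
proof -
  obtain G where G: "history_factor t G"
    using history_factor_exists[OF N t] by blast
  interpret S: prob_space "std_noise N"
    by (rule prob_space_std_noise)
  note [measurable] = measurable_qcare_history[of t] measurable_block[OF t, of False] A
    action_measurable[OF t] measurable_qcare_choice[OF N]
  let ?S = "history_space N t \<Otimes>\<^sub>M arm_space"
  have i_sets[measurable]: "{i} \<in> sets (count_space {1..N})"
    using i by simp
  have choice_sets: "{x\<in>space ?S. qcare_choice N \<alpha> t (fst x) (snd x) = i} \<in> sets ?S"
    using measurable_sets[OF measurable_qcare_choice[OF N] i_sets] by (simp add: vimage_def Int_def conj_commute)
  define E where "E = {x\<in>space ?S. fst x \<in> A \<and> qcare_choice N \<alpha> t (fst x) (snd x) = i}"
  have E[measurable]: "E \<in> sets ?S"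
    unfolding E_def by (intro sets.sets_Collect_conj choice_sets) measurable
  have HZ: "(\<lambda>\<omega>. (qcare_history t \<omega>, noise t \<omega>)) \<in> M \<rightarrow>\<^sub>M ?S"
    by measurable
  have "emeasure M {\<omega>\<in>space M. qcare_history t \<omega> \<in> A \<and> a t \<omega> = i} =
      emeasure M ((\<lambda>\<omega>. (qcare_history t \<omega>, noise t \<omega>)) -` E \<inter> space M)"
  proof (rule emeasure_eq_AE)
    show "AE \<omega> in M. \<omega> \<in> {\<omega>\<in>space M. qcare_history t \<omega> \<in> A \<and> a t \<omega> = i} \<longleftrightarrow>
        \<omega> \<in> (\<lambda>\<omega>. (qcare_history t \<omega>, noise t \<omega>)) -` E \<inter> space M"
      using AE_action_eq_choice[OF N t G]
      by eventually_elim (use HZ[THEN measurable_space] in \<open>auto simp: E_def\<close>)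
    show "(\<lambda>\<omega>. (qcare_history t \<omega>, noise t \<omega>)) -` E \<inter> space M \<in> sets M"
      by (rule measurable_sets[OF HZ E])
  qed measurable
  also have "\<dots> = emeasure (distr M (history_space N t) (qcare_history t) \<Otimes>\<^sub>M std_noise N) E"
    unfolding distr_history_noise[OF N t G, symmetric] by (rule emeasure_distr[OF HZ E, symmetric])
  also have "\<dots> = (\<integral>\<^sup>+h. emeasure (std_noise N) (Pair h -` E) \<partial>distr M (history_space N t) (qcare_history t))"
  proof (rule S.emeasure_pair_measure_alt)
    have "sets (distr M (history_space N t) (qcare_history t) \<Otimes>\<^sub>M std_noise N) = sets ?S"
      by (intro sets_pair_measure_cong) (auto simp: sets_std_noise)
    then show "E \<in> sets (distr M (history_space N t) (qcare_history t) \<Otimes>\<^sub>M std_noise N)"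
      using E by simp
  qed
  also have "\<dots> = (\<integral>\<^sup>+\<omega>. emeasure (std_noise N) (Pair (qcare_history t \<omega>) -` E) \<partial>M)"
  proof -
    have "sets (history_space N t \<Otimes>\<^sub>M std_noise N) = sets ?S"
      by (intro sets_pair_measure_cong) (auto simp: sets_std_noise)
    then have "(\<lambda>h. emeasure (std_noise N) (Pair h -` E)) \<in> borel_measurable (history_space N t)"
      using E by (intro S.measurable_emeasure_Pair) simp
    then show ?thesis
      by (intro nn_integral_distr) simp_all
  qed
  also have "\<dots> = (\<integral>\<^sup>+\<omega>. ennreal (indicator A (qcare_history t \<omega>) * measure (qcare_policy t (qcare_history t \<omega>)) {i}) \<partial>M)"
  proof (rule nn_integral_cong)
    fix \<omega> assume "\<omega> \<in> space M"
    then have h: "qcare_history t \<omega> \<in> space (history_space N t)"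
      by (rule measurable_space[OF measurable_qcare_history])
    have choice: "qcare_choice N \<alpha> t (qcare_history t \<omega>) \<in> std_noise N \<rightarrow>\<^sub>M count_space {1..N}"
      using measurable_compose[OF measurable_Pair1'[OF h] measurable_qcare_choice[OF N]]
      by (simp cong: measurable_cong_sets add: sets_std_noise)
    have "space (std_noise N) = space arm_space"
      by (rule sets_eq_imp_space_eq) (rule sets_std_noise)
    then have "Pair (qcare_history t \<omega>) -` E = (if qcare_history t \<omega> \<in> A then
        qcare_choice N \<alpha> t (qcare_history t \<omega>) -` {i} \<inter> space (std_noise N) else {})"
      using h by (auto simp: E_def space_pair_measure)
    moreover have "measure (qcare_policy t (qcare_history t \<omega>)) {i} =
        S.prob (qcare_choice N \<alpha> t (qcare_history t \<omega>) -` {i} \<inter> space (std_noise N))"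
      unfolding qcare_policy_def by (rule measure_distr[OF choice i_sets])
    ultimately show "emeasure (std_noise N) (Pair (qcare_history t \<omega>) -` E) =
        ennreal (indicator A (qcare_history t \<omega>) * measure (qcare_policy t (qcare_history t \<omega>)) {i})"
      by (simp add: S.emeasure_eq_measure split: split_indicator)
  qed
  finally have *: "emeasure M {\<omega>\<in>space M. qcare_history t \<omega> \<in> A \<and> a t \<omega> = i} =
      (\<integral>\<^sup>+\<omega>. ennreal (indicator A (qcare_history t \<omega>) * measure (qcare_policy t (qcare_history t \<omega>)) {i}) \<partial>M)" .
  have "qcare_policy t \<in> history_space N t \<rightarrow>\<^sub>M prob_algebra (count_space {1..N})"
    using admissible_qcare_policy[OF N] t by (simp add: admissible_policy_def)
  then have "(\<lambda>h. measure (qcare_policy t h) {i}) \<in> borel_measurable (history_space N t)"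
    by (rule measurable_compose[OF measurable_prob_algebraD measurable_measure_subprob_algebra]) (rule i_sets)
  note [measurable] = this
  have "(\<integral>\<omega>. indicator A (qcare_history t \<omega>) * measure (qcare_policy t (qcare_history t \<omega>)) {i} \<partial>M) =
      enn2real (\<integral>\<^sup>+\<omega>. ennreal (indicator A (qcare_history t \<omega>) * measure (qcare_policy t (qcare_history t \<omega>)) {i}) \<partial>M)"
    by (rule integral_eq_nn_integral) auto
  also have "\<dots> = enn2real (emeasure M {\<omega>\<in>space M. qcare_history t \<omega> \<in> A \<and> a t \<omega> = i})"
    by (rule arg_cong[where f = enn2real, OF *[symmetric]])
  also have "\<dots> = prob {\<omega>\<in>space M. qcare_history t \<omega> \<in> A \<and> a t \<omega> = i}"
    by (rule Sigma_Algebra.measure_def[symmetric])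
  finally show ?thesis ..
qed

text \<open>The earlier blocks and the noise of time \<open>t\<close> determine history and action
  almost surely, while the reward vector of time \<open>t\<close> is a separate block and therefore
  independent of both.\<close>

lemma reward_law:
  assumes N: "N > 0" and t: "t \<ge> 1" and i: "i \<in> {1..N}" and A: "A \<in> sets (history_space N t)"
    and B: "B \<in> sets borel"
  shows "prob {\<omega>\<in>space M. qcare_history t \<omega> \<in> A \<and> a t \<omega> = i \<and> observed_reward r a t \<omega> \<in> B} =
    prob {\<omega>\<in>space M. qcare_history t \<omega> \<in> A \<and> a t \<omega> = i} * measure (D i) B"
proof -
  obtain G where G: "history_factor t G"
    using history_factor_exists[OF N t] by blast
  then have G_meas: "G \<in> block_space (past t) \<rightarrow>\<^sub>M history_space N t"
    and G_AE: "AE \<omega> in M. qcare_history t \<omega> = G (\<lambda>j\<in>past t. block j \<omega>)"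
    by (auto simp: history_factor_def)
  \<comment> \<open>The current noise joins the past because the action uses it; the current reward
    block stays outside.\<close>
  let ?J = "past t \<union> {(False, t)}"
  let ?U = "\<lambda>\<omega>. \<lambda>j\<in>?J. block j \<omega>" and ?V = "\<lambda>\<omega>. \<lambda>j\<in>{(True, t)}. block j \<omega>"
  have ind: "indep_var (block_space ?J) ?U (block_space {(True, t)}) ?V"
    by (rule indep_var_restrict[OF indep_blocks]) (use t in auto)
  define P where "P y = G (restrict y (past t))" for y :: "bool \<times> nat \<Rightarrow> nat \<Rightarrow> real"
  have P[measurable]: "P \<in> block_space ?J \<rightarrow>\<^sub>M history_space N t"
    unfolding P_def by (rule measurable_compose[OF measurable_restrict_subset G_meas]) auto
  have comp: "(\<lambda>y. y (False, t)) \<in> block_space ?J \<rightarrow>\<^sub>M arm_space"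
    by (rule measurable_component_singleton) simp
  define E where "E = {y\<in>space (block_space ?J). P y \<in> A \<and> qcare_choice N \<alpha> t (P y) (y (False, t)) = i}"
  \<comment> \<open>Coordinate \<open>i\<close> is the right one to read: on the event
    \<open>a t \<omega> = i\<close> the observed reward is \<open>r i t \<omega>\<close>.\<close>
  define F where "F = {y\<in>space (block_space {(True, t)}). y (True, t) i \<in> B}"
  have choice: "(\<lambda>y. qcare_choice N \<alpha> t (P y) (y (False, t))) \<in> block_space ?J \<rightarrow>\<^sub>M count_space {1..N}"
    using measurable_compose[OF measurable_Pair[OF P comp] measurable_qcare_choice[OF N]] by simp
  have E: "E \<in> sets (block_space ?J)"
  proof -
    have "E = (P -` A \<inter> space (block_space ?J)) \<inter>
        ((\<lambda>y. qcare_choice N \<alpha> t (P y) (y (False, t))) -` {i} \<inter> space (block_space ?J))"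
      by (auto simp: E_def)
    also have "\<dots> \<in> sets (block_space ?J)"
      using i by (intro sets.Int measurable_sets[OF P A] measurable_sets[OF choice]) auto
    finally show ?thesis .
  qed
  have "(\<lambda>y. y (True, t) i) \<in> borel_measurable (block_space {(True, t)})"
    by (rule measurable_compose[OF measurable_component_singleton[of "(True, t)"] measurable_component_singleton[of i]])
      (use i in auto)
  from measurable_sets[OF this B] have F: "F \<in> sets (block_space {(True, t)})"
    by (simp add: F_def vimage_def Int_def conj_commute)
  have U_space: "?U \<omega> \<in> space (block_space ?J)" "?V \<omega> \<in> space (block_space {(True, t)})" if "\<omega> \<in> space M" for \<omega>
    using ind[THEN indep_var_rv1, THEN measurable_space, OF that]
      ind[THEN indep_var_rv2, THEN measurable_space, OF that] by auto
  have AE: "AE \<omega> in M. \<omega> \<in> space M \<and> (?U \<omega> \<in> E \<longleftrightarrow> qcare_history t \<omega> \<in> A \<and> a t \<omega> = i)"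
    using G_AE AE_action_eq_choice[OF N t G] AE_space
  proof eventually_elim
    case (elim \<omega>)
    have "restrict (?U \<omega>) (past t) = (\<lambda>j\<in>past t. block j \<omega>)"
      by (rule ext) auto
    then have "P (?U \<omega>) = qcare_history t \<omega>"
      using elim(1) by (simp add: P_def)
    moreover have "?U \<omega> (False, t) = noise t \<omega>"
      by simp
    ultimately show ?case
      using elim U_space(1)[OF elim(3)] unfolding E_def by auto
  qed
  have V: "?V \<omega> \<in> F \<longleftrightarrow> r i t \<omega> \<in> B" if "\<omega> \<in> space M" for \<omega>
    using U_space(2)[OF that] i by (simp add: F_def block_simps)
  note [measurable] = measurable_qcare_history[of t] A B measurable_observed_reward[OF t]
    action_measurable[OF t]
  have i_sets[measurable]: "{i} \<in> sets (count_space {1..N})"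
    using i by simp
  have "prob {\<omega>\<in>space M. qcare_history t \<omega> \<in> A \<and> a t \<omega> = i \<and> observed_reward r a t \<omega> \<in> B} =
      prob ((\<lambda>\<omega>. (?U \<omega>, ?V \<omega>)) -` (E \<times> F) \<inter> space M)"
  proof (rule finite_measure_eq_AE)
    show "AE \<omega> in M. \<omega> \<in> {\<omega>\<in>space M. qcare_history t \<omega> \<in> A \<and> a t \<omega> = i \<and> observed_reward r a t \<omega> \<in> B} \<longleftrightarrow>
        \<omega> \<in> (\<lambda>\<omega>. (?U \<omega>, ?V \<omega>)) -` (E \<times> F) \<inter> space M"
      using AE by eventually_elim (use V in \<open>auto simp: observed_reward_def simp del: restrict_apply\<close>)
    show "(\<lambda>\<omega>. (?U \<omega>, ?V \<omega>)) -` (E \<times> F) \<inter> space M \<in> sets M"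
      by (rule measurable_sets[OF measurable_Pair[OF ind[THEN indep_var_rv1] ind[THEN indep_var_rv2]]])
        (use E F in auto)
  qed measurable
  also have "\<dots> = prob (?U -` E \<inter> space M) * prob (?V -` F \<inter> space M)"
    by (rule indep_varD[OF ind E F])
  also have "prob (?U -` E \<inter> space M) = prob {\<omega>\<in>space M. qcare_history t \<omega> \<in> A \<and> a t \<omega> = i}"
  proof (rule finite_measure_eq_AE)
    show "AE \<omega> in M. \<omega> \<in> ?U -` E \<inter> space M \<longleftrightarrow> \<omega> \<in> {\<omega>\<in>space M. qcare_history t \<omega> \<in> A \<and> a t \<omega> = i}"
      using AE by eventually_elim (auto simp del: restrict_apply)
    show "?U -` E \<inter> space M \<in> sets M"
      by (rule measurable_sets[OF ind[THEN indep_var_rv1] E])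
  qed measurable
  also have "?V -` F \<inter> space M = r i t -` B \<inter> space M"
    using V by auto
  also have "prob (r i t -` B \<inter> space M) = measure (D i) B"
    using measure_distr[OF measurable_reward[OF i t] B] reward_distr[OF i t] by simp
  finally show ?thesis .
qed

lemma policy_run_qcare_policy:
  assumes "N > 0"
  shows "policy_run N D qcare_policy M a (observed_reward r a)"
  by unfold_locales
    (use action_measurable measurable_observed_reward action_law reward_law assms in auto)

end

section \<open>Exploration and convergence\<close>

lemma emp_mean_bounded:
  assumes "\<And>l. l \<in> {1..<t} \<Longrightarrow> r i l \<omega> \<in> {0..1}"
  shows "emp_mean r a i t \<omega> \<in> {0..1}"
proof -
  let ?A = "{l\<in>{1..<t}. a l \<omega> = i}"
  have "(\<Sum>l\<in>?A. r i l \<omega>) \<le> (\<Sum>l\<in>?A. 1)"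
    using assms by (intro sum_mono) auto
  then have "(\<Sum>l\<in>?A. r i l \<omega>) \<le> real (num_plays a i t \<omega>)"
    by (simp add: num_plays_def)
  moreover have "0 \<le> (\<Sum>l\<in>?A. r i l \<omega>)"
    using assms by (intro sum_nonneg) auto
  ultimately show ?thesis
    by (simp add: emp_mean_def divide_le_eq)
qed

section \<open>Positive probability of exploring noise\<close>

lemma emeasure_std_normal_pos:
  assumes A: "A \<in> sets borel" and "emeasure lborel A \<noteq> 0"
  shows "emeasure (density lborel std_normal_density) A > 0"
proof (rule ccontr)
  assume "\<not> 0 < emeasure (density lborel std_normal_density) A"
  then have "A \<in> null_sets (density lborel std_normal_density)"
    using A by (simp add: null_sets_def)
  then have "AE x in density lborel std_normal_density. x \<notin> A"
    by (rule AE_not_in)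
  then have "AE x in lborel. x \<notin> A"
    by (subst (asm) AE_density) (auto simp: normal_density_pos)
  then have "emeasure lborel A = 0"
    using A by (subst (asm) AE_iff_null_sets[symmetric]) auto
  with assms show False by simp
qed

definition exploring_noise :: "nat \<Rightarrow> nat \<Rightarrow> real \<Rightarrow> (nat \<Rightarrow> real) set" where
  "exploring_noise N i x = (\<Pi>\<^sub>E j\<in>{1..N}. if j = i then {x<..} else {..0})"

lemma sets_exploring_noise: "exploring_noise N i x \<in> sets (\<Pi>\<^sub>M i\<in>{1..N}. borel)"
  unfolding exploring_noise_def by (intro sets_PiM_I_finite) auto

lemma measure_exploring_noise_pos: "measure (std_noise N) (exploring_noise N i x) > 0"
proof -
  interpret S: prob_space "std_noise N"
    by (rule prob_space_std_noise)
  interpret product_sigma_finite "\<lambda>_::nat. density lborel std_normal_density"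
    by (rule product_sigma_finite.intro) (rule prob_space_imp_sigma_finite[OF prob_space_std_normal])
  have Ioi: "emeasure (density lborel std_normal_density) {x<..} > 0"
  proof (rule emeasure_std_normal_pos)
    have "emeasure lborel {x<..<x + 1} \<le> emeasure lborel {x<..}"
      by (rule emeasure_mono) auto
    then show "emeasure lborel {x<..} \<noteq> 0"
      by auto
  qed simp
  have Iic: "emeasure (density lborel std_normal_density) {..0} > 0"
  proof (rule emeasure_std_normal_pos)
    have "emeasure lborel {-1..0::real} \<le> emeasure lborel {..0::real}"
      by (rule emeasure_mono) auto
    then show "emeasure lborel {..0::real} \<noteq> 0"
      by auto
  qed simp
  interpret E: prob_space "density lborel std_normal_density"
    by (rule prob_space_std_normal)
  have "emeasure (std_noise N) (exploring_noise N i x) =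
      (\<Prod>j\<in>{1..N}. emeasure (density lborel std_normal_density) (if j = i then {x<..} else {..0}))"
    unfolding std_noise_def exploring_noise_def by (rule emeasure_PiM) auto
  also have "\<dots> = ennreal (\<Prod>j\<in>{1..N}. measure (density lborel std_normal_density) (if j = i then {x<..} else {..0}))"
    unfolding E.emeasure_eq_measure by (rule prod_ennreal) simp
  also have "\<dots> > 0"
    using Ioi Iic by (auto simp: E.emeasure_eq_measure intro!: prod_pos)
  finally show ?thesis
    by (simp add: S.emeasure_eq_measure)
qed

text \<open>\<open>K\<close> is chosen first to make \<open>b K\<close> small, then \<open>t\<close>
  is taken large for that \<open>K\<close>. The convergence of \<open>g K\<close> may thus become
  arbitrarily slow as \<open>K\<close> grows, as it does when ever larger noise is demanded.\<close>

lemma LIMSEQ_zero_by_two_scales: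
  fixes f b :: "nat \<Rightarrow> real" and g :: "nat \<Rightarrow> nat \<Rightarrow> real"
  assumes nonneg: "\<And>t. 0 \<le> f t"
    and bound: "\<And>K t. K \<ge> K0 \<Longrightarrow> t \<ge> 1 \<Longrightarrow> f t \<le> g K t + b K"
    and g: "\<And>K. g K \<longlonglongrightarrow> 0" and b: "b \<longlonglongrightarrow> 0"
  shows "f \<longlonglongrightarrow> 0"
proof (rule order_tendstoI)
  fix e :: real assume "e > 0"
  have "\<forall>\<^sub>F K in sequentially. b K < e / 2"
    using order_tendstoD(2)[OF b, of "e / 2"] \<open>e > 0\<close> by simp
  then have "\<forall>\<^sub>F K in sequentially. b K < e / 2 \<and> K \<ge> K0"
    using eventually_ge_at_top by (rule eventually_conj)
  then obtain K where K: "b K < e / 2" "K \<ge> K0"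
    using eventually_happens'[OF sequentially_bot] by blast
  have "\<forall>\<^sub>F t in sequentially. g K t < e / 2"
    using order_tendstoD(2)[OF g, of "e / 2" K] \<open>e > 0\<close> by simp
  then show "\<forall>\<^sub>F t in sequentially. f t < e"
    using eventually_ge_at_top[of 1]
  proof eventually_elim
    case (elim t)
    with bound[OF K(2), of t] K(1) show ?case by simp
  qed
qed (auto intro: always_eventually less_le_trans nonneg)

text \<open>The terms before \<open>K\<close> contribute at most the constant \<open>C\<close>,
  which division by a large \<open>T\<close> makes negligible; the others are below
  \<open>e / 2\<close> each.\<close>

lemma LIMSEQ_average:
  fixes f :: "nat \<Rightarrow> real"
  assumes f: "f \<longlonglongrightarrow> 0"
  shows "(\<lambda>T. (\<Sum>t\<in>{1..T}. f t) / real T) \<longlonglongrightarrow> 0"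
proof (rule LIMSEQ_I)
  fix e :: real assume "e > 0"
  then obtain K where K: "\<And>t. t \<ge> K \<Longrightarrow> \<bar>f t\<bar> < e / 2"
    using LIMSEQ_D[OF f, of "e / 2"] by auto
  define C where "C = (\<Sum>t<K. \<bar>f t\<bar>)"
  have sum_le: "\<bar>\<Sum>t\<in>{1..T}. f t\<bar> \<le> C + real T * (e / 2)" for T
  proof -
    have "\<bar>\<Sum>t\<in>{1..T}. f t\<bar> \<le> (\<Sum>t\<in>{1..T}. \<bar>f t\<bar>)"
      by (rule sum_abs)
    also have "\<dots> \<le> (\<Sum>t\<in>{1..T}. (if t < K then \<bar>f t\<bar> else 0) + e / 2)"
      using K \<open>e > 0\<close> by (intro sum_mono) (auto simp: not_less intro: less_imp_le)
    also have "\<dots> = (\<Sum>t\<in>{1..T}. if t < K then \<bar>f t\<bar> else 0) + real T * (e / 2)"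
      by (simp add: sum.distrib)
    also have "(\<Sum>t\<in>{1..T}. if t < K then \<bar>f t\<bar> else 0) = (\<Sum>t\<in>{t\<in>{1..T}. t < K}. \<bar>f t\<bar>)"
      by (rule sum.inter_filter[symmetric]) simp
    also have "\<dots> \<le> C"
      unfolding C_def by (rule sum_mono2) auto
    finally show ?thesis by simp
  qed
  obtain T0 :: nat where T0: "2 * C / e < real T0"
    using reals_Archimedean2 by blast
  have "\<bar>(\<Sum>t\<in>{1..T}. f t) / real T\<bar> < e" if T: "T \<ge> Suc T0" for T
  proof -
    have "C < real T * (e / 2)"
    proof -
      have "2 * C / e < real T"
        using T0 T by simp
      then show ?thesis
        using \<open>e > 0\<close> by (simp add: field_simps)
    qed
    with sum_le[of T] have "\<bar>\<Sum>t\<in>{1..T}. f t\<bar> < real T * e"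
      by (simp add: field_simps)
    then show ?thesis
      using T by (simp add: abs_divide divide_less_eq mult.commute)
  qed
  then show "\<exists>T0. \<forall>T\<ge>T0. norm ((\<Sum>t\<in>{1..T}. f t) / real T - 0) < e"
    by auto
qed

section \<open>Exploration by large noise\<close>

context qcare_run
begin

lemma noise_tail:
  assumes i: "i \<in> {1..N}" and t: "t \<ge> 1" and "x > 0"
  shows "prob {\<omega>\<in>space M. x \<le> \<bar>\<epsilon> i t \<omega>\<bar>} \<le> 1 / x\<^sup>2"
proof -
  note D = noise_distr[OF i t]
  have "integrable M (\<lambda>\<omega>. (\<epsilon> i t \<omega>)\<^sup>2)"
    using distributed_integrable[OF D, of "\<lambda>x. x\<^sup>2"] integrable_std_normal_moment[of 2] by simp
  from Chebyshev_inequality[OF measurable_noise[OF i t] this \<open>x > 0\<close>]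
  have "prob {\<omega>\<in>space M. x \<le> \<bar>\<epsilon> i t \<omega> - expectation (\<epsilon> i t)\<bar>} \<le> 1 / x\<^sup>2"
    by (simp only: standard_normal_distributed_variance[OF D])
  then show ?thesis
    by (simp only: standard_normal_distributed_expectation[OF D] diff_0_right)
qed

text \<open>Empirical means lie in the unit interval, so a scaled noise above 1 for arm
  \<open>i\<close> beats any arm whose noise is nonpositive.\<close>

lemma exploring_noise_forces_action:
  assumes \<alpha>: "\<alpha> > 0" and t: "t \<ge> 1" and \<omega>: "\<omega> \<in> space M" and i: "i \<in> {1..N}"
    and bounded: "\<And>j l. j \<in> {1..N} \<Longrightarrow> l \<ge> 1 \<Longrightarrow> r j l \<omega> \<in> {0..1}"
    and plays: "num_plays a i t \<omega> < K" and noise: "noise t \<omega> \<in> exploring_noise N i (real K powr \<alpha>)"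
  shows "a t \<omega> = i"
proof (rule ccontr)
  assume neq: "a t \<omega> \<noteq> i"
  define j where "j = a t \<omega>"
  have j: "j \<in> {1..N}" "j \<noteq> i"
    using measurable_space[OF action_measurable[OF t] \<omega>] neq by (auto simp: j_def)
  have \<epsilon>: "\<epsilon> i t \<omega> > real K powr \<alpha>" "\<epsilon> j t \<omega> \<le> 0"
    using noise i j by (auto simp: exploring_noise_def block_simps PiE_iff split: if_splits)
  \<comment> \<open>The strict bound \<open>num_plays a i t \<omega> < K\<close> absorbs the
    \<open>+ 1\<close> of the index exactly.\<close>
  have "(real (num_plays a i t \<omega>) + 1) powr \<alpha> \<le> real K powr \<alpha>"
    using plays \<alpha> by (intro powr_mono2) auto
  then have "1 < \<epsilon> i t \<omega> / (real (num_plays a i t \<omega>) + 1) powr \<alpha>"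
    using \<epsilon>(1) by (simp add: less_divide_eq)
  moreover have "emp_mean r a i t \<omega> \<ge> 0" "emp_mean r a j t \<omega> \<le> 1"
    using emp_mean_bounded[of t r i \<omega> a] emp_mean_bounded[of t r j \<omega> a] bounded i j by auto
  moreover have "\<epsilon> j t \<omega> / (real (num_plays a j t \<omega>) + 1) powr \<alpha> \<le> 0"
    using \<epsilon>(2) by (simp add: divide_le_0_iff)
  ultimately have "qcare_index \<alpha> r \<epsilon> a j t \<omega> < qcare_index \<alpha> r \<epsilon> a i t \<omega>"
    unfolding qcare_index_def by linarith
  then show False
    using action_arg_max[OF t \<omega>] i by (auto simp: is_arg_max_def j_def)
qed

lemma AE_rewards_bounded:
  assumes "bandit_instance N D"
  shows "AE \<omega> in M. \<forall>j\<in>{1..N}. \<forall>l\<in>{1..}. r j l \<omega> \<in> {0..1}"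
proof -
  have "AE \<omega> in M. r j l \<omega> \<in> {0..1}" if jl: "j \<in> {1..N}" "l \<in> {1..}" for j l
  proof -
    have "distr M borel (r j l) = D j"
      by (rule reward_distr) (use jl in auto)
    then have "AE x in distr M borel (r j l). x \<in> {0..1}"
      using assms jl unfolding bandit_instance_def by metis
    then show ?thesis
      using measurable_reward[of j l] jl by (subst (asm) AE_distr_iff) auto
  qed
  then show ?thesis
    by (simp add: AE_ball_countable)
qed

text \<open>While arm \<open>i\<close> has fewer than \<open>K\<close> plays it is played in every exploring round, so there are fewer
  than \<open>K\<close> such rounds; Markov's inequality is applied to \<open>2\<close> to the power minus their number.\<close>

lemma prob_few_plays_le:
  assumes \<alpha>: "\<alpha> > 0" and N: "N > 0" and D: "bandit_instance N D" and i: "i \<in> {1..N}"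
  shows "prob {\<omega>\<in>space M. num_plays a i (Suc t) \<omega> < K} \<le>
    2 ^ K * (1 - measure (std_noise N) (exploring_noise N i (real K powr \<alpha>)) / 2) ^ t"
proof -
  define G where "G = exploring_noise N i (real K powr \<alpha>)"
  define p where "p = measure (std_noise N) G"
  interpret S: prob_space "std_noise N"
    by (rule prob_space_std_noise)
  have p: "p \<le> 1"
    by (simp add: p_def)
  have G: "G \<in> sets arm_space"
    unfolding G_def by (rule sets_exploring_noise)
  \<comment> \<open>A factor \<open>1 / 2\<close> for an exploring round and 1 otherwise. The
    product over the rounds is the power of 2 to be estimated, and its factors are independent with
    mean \<open>1 - p / 2\<close>.\<close>
  define Z where "Z l \<omega> = (1 - indicator G (noise l \<omega>) / 2 :: real)" for l \<omega>
  let ?few = "{\<omega>\<in>space M. num_plays a i (Suc t) \<omega> < K}"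
  have Z_indep: "indep_vars (\<lambda>_. borel) (\<lambda>l \<omega>. ennreal (Z l \<omega>)) {1..<Suc t}"
  proof -
    have "indep_vars (\<lambda>_. arm_space) block ((\<lambda>l. (False, l)) ` {1..<Suc t})"
      by (rule indep_vars_subset[OF indep_blocks]) auto
    then have "indep_vars (\<lambda>_. arm_space) (\<lambda>l. noise l) {1..<Suc t}"
      by (rule indep_vars_reindex_inj[rotated]) (simp add: inj_on_def)
    moreover have "(\<lambda>z. ennreal (1 - indicator G z / 2)) \<in> borel_measurable arm_space"
      using G by measurable
    ultimately have "indep_vars (\<lambda>_. borel) (\<lambda>l \<omega>. (\<lambda>z. ennreal (1 - indicator G z / 2)) (noise l \<omega>)) {1..<Suc t}"
      by (rule indep_vars_compose2)
    then show ?thesis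
      by (simp only: Z_def)
  qed
  have Z_int: "(\<integral>\<^sup>+\<omega>. ennreal (Z l \<omega>) \<partial>M) = ennreal (1 - p / 2)" if l: "l \<ge> 1" for l
  proof -
    note [measurable] = measurable_block[OF l, of False] G
    have ev: "noise l -` G \<inter> space M \<in> events"
      by (rule measurable_sets[OF measurable_block[OF l] G])
    have "expectation (Z l) = expectation (\<lambda>\<omega>. 1 - indicator (noise l -` G \<inter> space M) \<omega> / 2)"
      by (rule Bochner_Integration.integral_cong) (simp_all add: Z_def indicator_def)
    also have "\<dots> = 1 - prob (noise l -` G \<inter> space M) / 2"
      using ev by (subst Bochner_Integration.integral_diff) (auto simp: prob_space integrable_indicator_iff less_top[symmetric])
    also have "prob (noise l -` G \<inter> space M) = p"
      unfolding p_def distr_noise[OF N l, symmetric] by (rule measure_distr[OF measurable_block[OF l] G, symmetric])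
    finally have "expectation (Z l) = 1 - p / 2" .
    moreover have "integrable M (Z l)"
    proof (rule integrable_const_bound[where B = 1])
      show "Z l \<in> borel_measurable M"
        unfolding Z_def by measurable
    qed (simp add: Z_def indicator_def)
    ultimately show ?thesis
      by (subst nn_integral_eq_integral) (simp_all add: Z_def indicator_def)
  qed
  have few: "AE \<omega> in M. indicator ?few \<omega> \<le> ennreal (2 ^ K) * (\<Prod>l\<in>{1..<Suc t}. ennreal (Z l \<omega>))"
    using AE_rewards_bounded[OF D] AE_space
  proof eventually_elim
    case (elim \<omega>)
    show ?case
    proof (cases "num_plays a i (Suc t) \<omega> < K")
      case True
      let ?E = "{l\<in>{1..<Suc t}. noise l \<omega> \<in> G}"
      have "?E \<subseteq> {l\<in>{1..<Suc t}. a l \<omega> = i}"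
      proof safe
        fix l assume l: "l \<in> {1..<Suc t}" "noise l \<omega> \<in> G"
        \<comment> \<open>Play counts only grow, so the arm is still below \<open>K\<close> plays at
          every earlier round, and each exploring round is spent on it.\<close>
        have "num_plays a i l \<omega> \<le> num_plays a i (Suc t) \<omega>"
          unfolding num_plays_def using l by (intro card_mono) auto
        with True have "num_plays a i l \<omega> < K"
          by simp
        moreover have "r j s \<omega> \<in> {0..1}" if "j \<in> {1..N}" "s \<ge> 1" for j s
          using elim(1) that by blast
        ultimately show "a l \<omega> = i"
          using exploring_noise_forces_action[OF \<alpha> _ elim(2) i, of l K] l unfolding G_def by simp
      qed
      then have "card ?E \<le> num_plays a i (Suc t) \<omega>"
        unfolding num_plays_def by (intro card_mono) auto
      with True have "card ?E \<le> K" by simp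
      have "(\<Prod>l\<in>{1..<Suc t}. Z l \<omega>) = (\<Prod>l\<in>{1..<Suc t}. if noise l \<omega> \<in> G then 1 / 2 else 1)"
        by (intro prod.cong) (auto simp: Z_def)
      also have "\<dots> = (1 / 2) ^ card ?E"
        by (subst prod.inter_filter[symmetric]) auto
      finally have "(\<Prod>l\<in>{1..<Suc t}. Z l \<omega>) \<ge> (1 / 2) ^ K"
        using power_decreasing[OF \<open>card ?E \<le> K\<close>, of "1 / 2 :: real"] by simp
      then have "1 \<le> 2 ^ K * (\<Prod>l\<in>{1..<Suc t}. Z l \<omega>)"
        by (simp add: power_one_over field_simps)
      moreover have "(\<Prod>l\<in>{1..<Suc t}. ennreal (Z l \<omega>)) = ennreal (\<Prod>l\<in>{1..<Suc t}. Z l \<omega>)"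
        by (rule prod_ennreal) (auto simp: Z_def split: split_indicator)
      ultimately show ?thesis
        using elim(2) True by (simp flip: ennreal_mult')
    qed simp
  qed
  have events: "?few \<in> events"
  proof -
    interpret bandit_run N D qcare_policy M a "observed_reward r a"
      using policy_run_qcare_policy[OF N] D by (simp add: bandit_run_def bandit_run_axioms_def)
    have "{\<omega>\<in>space M. real (num_plays a i (Suc t) \<omega>) < real K} \<in> events"
      using measurable_num_plays[OF i, of "Suc t"] by measurable
    then show ?thesis by simp
  qed
  have "ennreal (prob ?few) = (\<integral>\<^sup>+\<omega>. indicator ?few \<omega> \<partial>M)"
    using events by (simp add: emeasure_eq_measure)
  also have "\<dots> \<le> (\<integral>\<^sup>+\<omega>. ennreal (2 ^ K) * (\<Prod>l\<in>{1..<Suc t}. ennreal (Z l \<omega>)) \<partial>M)"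
    by (rule nn_integral_mono_AE[OF few])
  also have "\<dots> = ennreal (2 ^ K) * (\<integral>\<^sup>+\<omega>. (\<Prod>l\<in>{1..<Suc t}. ennreal (Z l \<omega>)) \<partial>M)"
    using Z_indep by (intro nn_integral_cmult borel_measurable_prod_ennreal) (auto simp: indep_vars_def)
  also have "(\<integral>\<^sup>+\<omega>. (\<Prod>l\<in>{1..<Suc t}. ennreal (Z l \<omega>)) \<partial>M) = (\<Prod>l\<in>{1..<Suc t}. \<integral>\<^sup>+\<omega>. ennreal (Z l \<omega>) \<partial>M)"
    by (rule indep_vars_nn_integral[OF _ Z_indep]) auto
  also have "\<dots> = (\<Prod>l\<in>{1..<Suc t}. ennreal (1 - p / 2))"
    by (rule prod.cong) (auto simp: Z_int)
  also have "ennreal (2 ^ K) * \<dots> = ennreal (2 ^ K * (1 - p / 2) ^ t)"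
    using p by (simp add: ennreal_power ennreal_mult)
  finally have "prob ?few \<le> 2 ^ K * (1 - p / 2) ^ t"
    by (rule ennreal_le_iff[THEN iffD1, rotated]) (use p in simp)
  then show ?thesis
    by (simp only: p_def G_def)
qed

lemma prob_few_plays_tendsto:
  assumes \<alpha>: "\<alpha> > 0" and N: "N > 0" and D: "bandit_instance N D" and i: "i \<in> {1..N}"
  shows "(\<lambda>t. prob {\<omega>\<in>space M. num_plays a i t \<omega> < K}) \<longlonglongrightarrow> 0"
proof -
  define p where "p = measure (std_noise N) (exploring_noise N i (real K powr \<alpha>))"
  define q where "q = 1 - p / 2"
  interpret S: prob_space "std_noise N"
    by (rule prob_space_std_noise)
  have "0 < p" "p \<le> 1"
    by (simp_all add: p_def measure_exploring_noise_pos)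
  then have "\<bar>q\<bar> < 1"
    by (simp add: q_def)
  then have "(\<lambda>t. 2 ^ K * q ^ t) \<longlonglongrightarrow> 2 ^ K * 0"
    by (intro tendsto_mult tendsto_const LIMSEQ_abs_realpow_zero2)
  then have lim: "(\<lambda>t. 2 ^ K * q ^ t) \<longlonglongrightarrow> 0"
    by (simp only: mult_zero_right)
  have le: "prob {\<omega>\<in>space M. num_plays a i (Suc t) \<omega> < K} \<le> 2 ^ K * q ^ t" for t
    unfolding q_def p_def by (rule prob_few_plays_le[OF assms])
  have "(\<lambda>t. prob {\<omega>\<in>space M. num_plays a i (Suc t) \<omega> < K}) \<longlonglongrightarrow> 0"
    by (rule tendsto_sandwich[OF _ _ tendsto_const lim]) (use le in \<open>auto intro: always_eventually\<close>)
  then show ?thesis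
    by (rule LIMSEQ_imp_Suc)
qed

text \<open>A wrong action requires, for some arm, too few plays, a large reward deviation or a
  large noise. For fixed \<open>K\<close> the first becomes unlikely with time, and the other two
  are bounded uniformly in time by a quantity vanishing as \<open>K\<close> grows.\<close>

lemma prob_suboptimal_tendsto:
  assumes \<alpha>: "\<alpha> > 0" and N: "N > 0" and D: "bandit_instance N D" and opt: "unique_optimal_arm N D istar"
  shows "(\<lambda>t. prob {\<omega>\<in>space M. a t \<omega> \<noteq> istar}) \<longlonglongrightarrow> 0"
proof -
  interpret run: bandit_run N D qcare_policy M a "observed_reward r a"
    using policy_run_qcare_policy[OF N] D by (simp add: bandit_run_def bandit_run_axioms_def)
  have istar: "istar \<in> {1..N}"
    using opt by (simp add: unique_optimal_arm_def is_arg_max_def)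
  have gap_pos: "arm_mean D i < arm_mean D istar" if "i \<in> {1..N}" "i \<noteq> istar" for i
  proof (rule ccontr)
    assume "\<not> arm_mean D i < arm_mean D istar"
    with opt that(1) have "is_arg_max (arm_mean D) (\<lambda>j. j \<in> {1..N}) i"
      unfolding unique_optimal_arm_def is_arg_max_linorder by (meson le_less_linear order_trans)
    with opt that(2) show False
      by (auto simp: unique_optimal_arm_def)
  qed
  \<comment> \<open>An index will be off by less than \<open>3 * \<delta>\<close>: two from the
    empirical mean and one from the noise. Two such errors stay below the gap of at least
    \<open>8 * \<delta>\<close>. The inserted 1 keeps the minimum over a nonempty set.\<close>
  define \<delta> where "\<delta> = Min (insert 1 ((\<lambda>i. arm_mean D istar - arm_mean D i) ` ({1..N} - {istar}))) / 8"
  have "\<delta> > 0"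
    using gap_pos by (auto simp: \<delta>_def)
  have gap: "arm_mean D i + 8 * \<delta> \<le> arm_mean D istar" if "i \<in> {1..N}" "i \<noteq> istar" for i
  proof -
    have "8 * \<delta> \<le> arm_mean D istar - arm_mean D i"
      unfolding \<delta>_def using that by (simp add: Min_le)
    then show ?thesis by simp
  qed
  define few where "few K t i = {\<omega>\<in>space M. num_plays a i t \<omega> < K}" for K t i
  define dev where "dev K t i = {\<omega>\<in>space M. K \<le> num_plays a i t \<omega> \<and> \<delta> * num_plays a i t \<omega> \<le>
      \<bar>reward_deviation a (observed_reward r a) i (arm_mean D i) t \<omega>\<bar>}" for K t i
  \<comment> \<open>The threshold uses \<open>K\<close> instead of the actual play count, which
    turns the event into one about a single Gaussian.\<close>
  define big where "big K t i = {\<omega>\<in>space M. \<delta> * real K powr \<alpha> \<le> \<bar>\<epsilon> i t \<omega>\<bar>}" for K :: nat and t i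
  \<comment> \<open>From \<open>K0\<close> on, \<open>\<delta> * K\<close> is at least 1 and so
    dominates the bias of the denominator \<open>k + 1\<close>, whose numerator is a mean in the
    unit interval.\<close>
  define K0 where "K0 = nat \<lceil>1 / \<delta>\<rceil>"
  have K0: "1 / \<delta> \<le> real K" "K > 0" if "K \<ge> K0" for K
  proof -
    have "1 / \<delta> \<le> real K0"
      unfolding K0_def by (rule real_nat_ceiling_ge)
    also have "\<dots> \<le> real K"
      using that by simp
    finally show "1 / \<delta> \<le> real K" .
    moreover have "1 / \<delta> > 0"
      using \<open>\<delta> > 0\<close> by simp
    ultimately show "K > 0"
      by (intro gr0I) auto
  qed
  \<comment> \<open>A pointwise statement: outside the bad events the indices are ordered well
    enough for the best arm to win.\<close>
  have optimal: "a t \<omega> = istar"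
    if K: "K \<ge> K0" and t: "t \<ge> 1" and \<omega>: "\<omega> \<in> space M"
      and ok: "\<And>i. i \<in> {1..N} \<Longrightarrow> \<omega> \<notin> few K t i \<union> dev K t i \<union> big K t i" for K t \<omega>
  proof (rule ccontr)
    have index: "\<bar>qcare_index \<alpha> r \<epsilon> a i t \<omega> - arm_mean D i\<bar> < 3 * \<delta>" if i: "i \<in> {1..N}" for i
    proof -
      define k where "k = real (num_plays a i t \<omega>)"
      define S where "S = reward_deviation a (observed_reward r a) i (arm_mean D i) t \<omega>"
      have k: "k \<ge> K" "k \<ge> 0" and S: "\<bar>S\<bar> < \<delta> * k" and \<epsilon>: "\<bar>\<epsilon> i t \<omega>\<bar> < \<delta> * real K powr \<alpha>"
        using ok[OF i] \<omega> by (auto simp: few_def dev_def big_def k_def S_def not_le not_less)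
      have "\<bar>emp_mean r a i t \<omega> - arm_mean D i\<bar> < 2 * \<delta>"
      proof -
        have "1 \<le> \<delta> * K"
          using K0(1)[OF K] \<open>\<delta> > 0\<close> by (simp add: field_simps)
        also have "\<dots> \<le> \<delta> * k"
          using k \<open>\<delta> > 0\<close> by simp
        finally have "\<bar>S - arm_mean D i\<bar> < \<delta> * k + \<delta> * k"
          using S run.arm_mean_bounded[OF i] by auto
        also have "\<dots> \<le> 2 * \<delta> * (k + 1)"
          using \<open>\<delta> > 0\<close> by (simp add: algebra_simps)
        finally show ?thesis
          unfolding emp_mean_deviation using k by (simp add: S_def k_def abs_divide divide_less_eq)
      qed
      moreover have "\<bar>\<epsilon> i t \<omega> / (k + 1) powr \<alpha>\<bar> < \<delta>"
      proof -
        have "real K powr \<alpha> \<le> (k + 1) powr \<alpha>"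
          using k \<alpha> by (intro powr_mono2) auto
        then have "\<delta> * real K powr \<alpha> \<le> \<delta> * (k + 1) powr \<alpha>"
          using \<open>\<delta> > 0\<close> by simp
        with \<epsilon> have "\<bar>\<epsilon> i t \<omega>\<bar> < \<delta> * (k + 1) powr \<alpha>"
          by simp
        then show ?thesis
          using k by (simp add: abs_divide divide_less_eq)
      qed
      ultimately show ?thesis
        unfolding qcare_index_def k_def[symmetric] by linarith
    qed
    assume neq: "a t \<omega> \<noteq> istar"
    have at: "a t \<omega> \<in> {1..N}"
      using measurable_space[OF action_measurable[OF t] \<omega>] by simp
    have "qcare_index \<alpha> r \<epsilon> a (a t \<omega>) t \<omega> < qcare_index \<alpha> r \<epsilon> a istar t \<omega>"
      using index[OF at] index[OF istar] gap[OF at neq] \<open>\<delta> > 0\<close> by (simp add: abs_less_iff)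
    then show False
      using action_arg_max[OF t \<omega>] istar by (auto simp: is_arg_max_def)
  qed
  have few_events: "few K t i \<in> events" if "i \<in> {1..N}" for K t i
  proof -
    have "{\<omega>\<in>space M. real (num_plays a i t \<omega>) < real K} \<in> events"
      using run.measurable_num_plays[OF that, of t] by measurable
    then show ?thesis by (simp add: few_def)
  qed
  have dev_events: "dev K t i \<in> events" if "i \<in> {1..N}" for K t i
  proof -
    note [measurable] = run.measurable_num_plays[OF that, of t] run.measurable_reward_deviation[OF that, of _ t]
    have "{\<omega>\<in>space M. real K \<le> real (num_plays a i t \<omega>) \<and> \<delta> * real (num_plays a i t \<omega>) \<le>
      \<bar>reward_deviation a (observed_reward r a) i (arm_mean D i) t \<omega>\<bar>} \<in> events"
      by measurable
    then show ?thesis by (simp add: dev_def)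
  qed
  have big_events: "big K t i \<in> events" if "i \<in> {1..N}" "t \<ge> 1" for K t i
    unfolding big_def using measurable_noise[OF that] by measurable
  define bad where "bad K t i = few K t i \<union> dev K t i \<union> big K t i" for K t i
  have bad_events: "bad K t i \<in> events" if "i \<in> {1..N}" "t \<ge> 1" for K t i
    unfolding bad_def by (intro sets.Un few_events dev_events big_events that)
  define b where "b K = 2 * exp (- 2 * \<delta>\<^sup>2 * real K) + 1 / (\<delta> * real K powr \<alpha>)\<^sup>2" for K :: nat
  have b: "b \<longlonglongrightarrow> 0"
    unfolding b_def using \<open>\<delta> > 0\<close> \<alpha> by real_asymp
  have bound: "prob {\<omega>\<in>space M. a t \<omega> \<noteq> istar} \<le> (\<Sum>i\<in>{1..N}. prob (few K t i)) + real N * b K"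
    if K: "K \<ge> K0" and t: "t \<ge> 1" for K t
  proof -
    have "prob {\<omega>\<in>space M. a t \<omega> \<noteq> istar} \<le> prob (\<Union>i\<in>{1..N}. bad K t i)"
    proof (rule finite_measure_mono)
      show "{\<omega>\<in>space M. a t \<omega> \<noteq> istar} \<subseteq> (\<Union>i\<in>{1..N}. bad K t i)"
      proof (rule subsetI, rule ccontr)
        fix \<omega> assume \<omega>: "\<omega> \<in> {\<omega>\<in>space M. a t \<omega> \<noteq> istar}" "\<omega> \<notin> (\<Union>i\<in>{1..N}. bad K t i)"
        have "a t \<omega> = istar"
          by (rule optimal[OF K t]) (use \<omega> in \<open>auto simp: bad_def\<close>)
        with \<omega>(1) show False
          by simp
      qed
      show "(\<Union>i\<in>{1..N}. bad K t i) \<in> events"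
        by (intro sets.finite_UN bad_events t) auto
    qed
    also have "\<dots> \<le> (\<Sum>i\<in>{1..N}. prob (bad K t i))"
      by (intro measure_UNION_le bad_events t) auto
    also have "\<dots> \<le> (\<Sum>i\<in>{1..N}. prob (few K t i) + b K)"
    proof (rule sum_mono)
      fix i assume i: "i \<in> {1..N}"
      have "prob (bad K t i) \<le> prob (few K t i \<union> dev K t i) + prob (big K t i)"
        unfolding bad_def by (intro measure_Un_le sets.Un few_events dev_events big_events i t)
      moreover have "prob (few K t i \<union> dev K t i) \<le> prob (few K t i) + prob (dev K t i)"
        by (intro measure_Un_le few_events dev_events i)
      moreover have "prob (dev K t i) \<le> 2 * exp (- 2 * \<delta>\<^sup>2 * K)"
        unfolding dev_def by (rule run.deviation_tail[OF i t \<open>\<delta> > 0\<close>])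
      moreover have "prob (big K t i) \<le> 1 / (\<delta> * real K powr \<alpha>)\<^sup>2"
        unfolding big_def using K0(2)[OF K] \<open>\<delta> > 0\<close>
        by (intro noise_tail[OF i t]) simp
      ultimately show "prob (bad K t i) \<le> prob (few K t i) + b K"
        unfolding b_def by linarith
    qed
    also have "\<dots> = (\<Sum>i\<in>{1..N}. prob (few K t i)) + real N * b K"
      by (simp add: sum.distrib)
    finally show ?thesis .
  qed
  have "(\<lambda>t. \<Sum>i\<in>{1..N}. prob (few K t i)) \<longlonglongrightarrow> (\<Sum>i\<in>{1..N}. 0)" for K
    unfolding few_def by (intro tendsto_sum prob_few_plays_tendsto[OF \<alpha> N D])
  then have few_lim: "(\<lambda>t. \<Sum>i\<in>{1..N}. prob (few K t i)) \<longlonglongrightarrow> 0" for K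
    by (simp only: sum.neutral_const)
  have "(\<lambda>K. real N * b K) \<longlonglongrightarrow> 0"
    using tendsto_mult[OF tendsto_const b, of "real N"] by simp
  from LIMSEQ_zero_by_two_scales[OF _ bound few_lim this] show ?thesis
    by simp
qed

end

section \<open>Regret and long-run average reward\<close>

lemma (in bandit_run) long_run_average_reward_le:
  "long_run_average_reward M X \<le> optimal_mean N D"
  unfolding long_run_average_reward_def
proof (rule Limsup_bounded, rule eventually_mono[OF eventually_gt_at_top[of 0]])
  fix T :: nat assume "T > 0"
  have "expected_total_reward M X T \<le> optimal_mean N D * real T"
    using regret_nonneg[of T] by (simp add: regret_def)
  then show "ereal (1 / real T * expected_total_reward M X T) \<le> ereal (optimal_mean N D)"
    using \<open>T > 0\<close> by (simp add: field_simps)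
qed

text \<open>All means lie in the unit interval, so a wrong action costs at most 1 and the expected
  loss of a step is at most the probability of a wrong action. These probabilities are then
  averaged.\<close>

lemma (in bandit_run) average_regret_tendsto_0:
  assumes opt: "unique_optimal_arm N D istar"
    and lim: "(\<lambda>t. prob {\<omega>\<in>space M. a t \<omega> \<noteq> istar}) \<longlonglongrightarrow> 0"
  shows "(\<lambda>T. regret N D M X T / real T) \<longlonglongrightarrow> 0"
proof -
  have istar: "istar \<in> {1..N}" and max: "\<And>j. j \<in> {1..N} \<Longrightarrow> arm_mean D j \<le> arm_mean D istar"
    using opt by (auto simp: unique_optimal_arm_def is_arg_max_linorder)
  have best: "optimal_mean N D = arm_mean D istar"
    unfolding optimal_mean_def by (rule Max_eqI) (use istar max in auto)
  have step: "(\<Sum>i\<in>{1..N}. prob {\<omega>\<in>space M. a t \<omega> = i} * (optimal_mean N D - arm_mean D i)) \<le>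
      prob {\<omega>\<in>space M. a t \<omega> \<noteq> istar}" if t: "t \<ge> 1" for t
  proof -
    have events: "{\<omega>\<in>space M. a t \<omega> = i} \<in> events" if "i \<in> {1..N}" for i
      using action_measurable[OF t] that by measurable
    have "(\<Sum>i\<in>{1..N}. prob {\<omega>\<in>space M. a t \<omega> = i} * (optimal_mean N D - arm_mean D i)) \<le>
        (\<Sum>i\<in>{1..N}. prob {\<omega>\<in>space M. a t \<omega> = i} * of_bool (i \<noteq> istar))"
    proof (intro sum_mono mult_left_mono)
      fix i assume "i \<in> {1..N}"
      then show "optimal_mean N D - arm_mean D i \<le> of_bool (i \<noteq> istar)"
        using arm_mean_bounded[of i] arm_mean_bounded[OF istar] by (auto simp: best)
    qed simp
    also have "\<dots> = (\<Sum>i\<in>{1..N}. prob {\<omega>\<in>space M. a t \<omega> = i}) - prob {\<omega>\<in>space M. a t \<omega> = istar}"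
    proof -
      have "(\<Sum>i\<in>{1..N}. prob {\<omega>\<in>space M. a t \<omega> = i} * of_bool (i \<noteq> istar)) =
          (\<Sum>i\<in>{1..N} - {istar}. prob {\<omega>\<in>space M. a t \<omega> = i})"
        by (rule sum.mono_neutral_cong_right) auto
      then show ?thesis
        using istar by (simp add: sum_diff1)
    qed
    also have "\<dots> = 1 - prob {\<omega>\<in>space M. a t \<omega> = istar}"
      by (simp only: prob_actions[OF t])
    also have "\<dots> = prob {\<omega>\<in>space M. a t \<omega> \<noteq> istar}"
      by (rule prob_neg[symmetric]) (rule events[OF istar])
    finally show ?thesis .
  qed
  show ?thesis
  proof (rule tendsto_sandwich[OF _ _ tendsto_const LIMSEQ_average[OF lim]])
    show "\<forall>\<^sub>F T in sequentially. 0 \<le> regret N D M X T / real T"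
      by (simp add: regret_nonneg)
    have "regret N D M X T / real T \<le> (\<Sum>t\<in>{1..T}. prob {\<omega>\<in>space M. a t \<omega> \<noteq> istar}) / real T" for T
      unfolding regret_eq by (intro divide_right_mono sum_mono step) auto
    then show "\<forall>\<^sub>F T in sequentially. regret N D M X T / real T \<le>
        (\<Sum>t\<in>{1..T}. prob {\<omega>\<in>space M. a t \<omega> \<noteq> istar}) / real T"
      by (rule always_eventually[OF allI])
  qed
qed

lemma long_run_average_reward_eq_optimal:
  assumes "(\<lambda>T. regret N D M X T / real T) \<longlonglongrightarrow> 0"
  shows "long_run_average_reward M X = optimal_mean N D"
proof -
  have "(\<lambda>T. optimal_mean N D - regret N D M X T / real T) \<longlonglongrightarrow> optimal_mean N D - 0"
    by (intro tendsto_diff tendsto_const assms)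
  moreover have "\<forall>\<^sub>F T in sequentially.
      optimal_mean N D - regret N D M X T / real T = 1 / real T * expected_total_reward M X T"
    using eventually_gt_at_top[of 0] by eventually_elim (simp add: regret_def field_simps)
  ultimately have "(\<lambda>T. 1 / real T * expected_total_reward M X T) \<longlonglongrightarrow> optimal_mean N D"
    by (simp add: tendsto_cong)
  then show ?thesis
    unfolding long_run_average_reward_def by (intro lim_imp_Limsup) auto
qed

text \<open>The existence of an admissible policy generating the run places QCARE in the class over
  which it is claimed to be optimal. Competitors live on a probability space of their own, hence the
  separate type \<open>'v\<close>.\<close>

theorem theorem1:
  fixes N :: nat and \<alpha> :: real and D :: "nat \<Rightarrow> real measure" and istar :: nat
    and M :: "'w measure" and r \<epsilon> :: "nat \<Rightarrow> nat \<Rightarrow> 'w \<Rightarrow> real" and a :: "nat \<Rightarrow> 'w \<Rightarrow> nat"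
  assumes "\<alpha> > 0" and "N > 1"
    and "bandit_instance N D" and "unique_optimal_arm N D istar"
    and "qcare_run N D \<alpha> M r \<epsilon> a"
  shows "(\<lambda>t. measure M {\<omega>\<in>space M. a t \<omega> = istar}) \<longlonglongrightarrow> 1 \<and>
    limsup (\<lambda>T. ereal (regret N D M (observed_reward r a) T / real T)) = 0 \<and>
    (\<exists>\<pi>. admissible_policy N \<pi> \<and> policy_run N D \<pi> M a (observed_reward r a)) \<and>
    (\<forall>\<pi> (M' :: 'v measure) a' X'.
       admissible_policy N \<pi> \<and> policy_run N D \<pi> M' a' X' \<longrightarrow>
       long_run_average_reward M' X' \<le> long_run_average_reward M (observed_reward r a))"
proof -
  interpret qcare_run N D \<alpha> M r \<epsilon> a
    by fact
  have N: "N > 0"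
    using \<open>N > 1\<close> by simp
  have istar: "istar \<in> {1..N}"
    using \<open>unique_optimal_arm N D istar\<close> by (simp add: unique_optimal_arm_def is_arg_max_def)
  note wrong = prob_suboptimal_tendsto[OF \<open>\<alpha> > 0\<close> N \<open>bandit_instance N D\<close> \<open>unique_optimal_arm N D istar\<close>]
  have "1 - prob {\<omega>\<in>space M. a t \<omega> \<noteq> istar} = prob {\<omega>\<in>space M. a t \<omega> = istar}" if "t \<ge> 1" for t
  proof -
    have "{\<omega>\<in>space M. a t \<omega> = istar} \<in> events"
      using action_measurable[OF that] istar by measurable
    from prob_neg[OF this] show ?thesis
      by simp
  qed
  then have "\<forall>\<^sub>F t in sequentially.
      1 - prob {\<omega>\<in>space M. a t \<omega> \<noteq> istar} = prob {\<omega>\<in>space M. a t \<omega> = istar}"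
    by (rule eventually_sequentiallyI)
  then have right: "(\<lambda>t. prob {\<omega>\<in>space M. a t \<omega> = istar}) \<longlonglongrightarrow> 1"
    using tendsto_diff[OF tendsto_const[of 1] wrong] by (simp add: tendsto_cong)
  note run = policy_run_qcare_policy[OF N]
  have avg: "(\<lambda>T. regret N D M (observed_reward r a) T / real T) \<longlonglongrightarrow> 0"
    by (rule bandit_run.average_regret_tendsto_0[OF _ \<open>unique_optimal_arm N D istar\<close> wrong])
      (use run \<open>bandit_instance N D\<close> in \<open>simp add: bandit_run_def bandit_run_axioms_def\<close>)
  then have "(\<lambda>T. ereal (regret N D M (observed_reward r a) T / real T)) \<longlonglongrightarrow> ereal 0"
    by (rule tendsto_ereal)
  then have "limsup (\<lambda>T. ereal (regret N D M (observed_reward r a) T / real T)) = 0"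
    by (simp add: lim_imp_Limsup zero_ereal_def)
  moreover have "long_run_average_reward M' X' \<le> long_run_average_reward M (observed_reward r a)"
    if "policy_run N D \<pi> M' a' X'" for \<pi> and M' :: "'v measure" and a' X'
  proof -
    have "bandit_run N D \<pi> M' a' X'"
      using that \<open>bandit_instance N D\<close> by (simp add: bandit_run_def bandit_run_axioms_def)
    from bandit_run.long_run_average_reward_le[OF this] show ?thesis
      by (simp only: long_run_average_reward_eq_optimal[OF avg])
  qed
  ultimately show ?thesis
    using right admissible_qcare_policy[OF N] run by blast
qed

end
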